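(* Let $\lambda\ge0$, $T>0$, and let $u_{0,1},u_{0,2}$ be finite Dirac mixtures on $\mathbb{R}^d$ with supports $A_1,A_2$. For $x_T\in\mathbb{R}^d$, let $X=(X_t)_{t\in(0,T]}$ be the solution of $\dot X_t=-\nabla V_\lambda(X_t,t)$, $t\in(0,T]$, with $X_T=x_T$, and let $Y_\tau:=X_{Te^{-\tau}}$, $\tau\ge0$. Assume that - if $0\le\lambda\le1$: $\ \omega_\tau(Y)\cap\bigl(\mathrm{Crit}(\Phi_\lambda)\setminus\mathrm{Min}(\Phi_\lambda)\bigr)=\varnothing$; - if $\lambda>1$: $\ \omega_\tau(Y)\cap\bigl(\mathrm{Crit}_{\mathrm{out}}(\Phi_\lambda)\setminus\mathrm{Min}(\Phi_\lambda)\bigr)=\varnothing$. Then there exists $x^\ast\in\mathrm{Min}(\Phi_\lambda)$ such that $Y_\tau\to x^\ast$ as $\tau\to\infty$; equivalently, $X_t\to x^\ast$ as $t\to0^+$.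
   Context: A finite Dirac mixture on $\mathbb{R}^d$ is a probability measure $\sum_{k=1}^n w_k\delta_{a_k}$ with $n\ge1$, $a_k\in\mathbb{R}^d$, $w_k>0$, $\sum_k w_k=1$. Its support is $\{a_1,\dots,a_n\}$. Heat flows: for $i=1,2$ and $t>0$, $u_i(\cdot,t)=G_t*u_{0,i}$ with $G_t(z)=(4\pi t)^{-d/2}e^{-\|z\|^2/(4t)}$. Set $V_\lambda(x,t)=\lambda\log u_1(x,t)+(1-\lambda)\log u_2(x,t)$; $\nabla$ is the gradient in $x$. Geometric potential: $A_i=\mathrm{supp}(u_{0,i})$, $d_i(x)=\mathrm{dist}(x,A_i)$, $\Phi_\lambda(x)=\lambda d_1(x)^2+(1-\lambda)d_2(x)^2$. Clarke subdifferential of a locally Lipschitz $f:\mathbb{R}^d\to\mathbb{R}$: $\partial^Cf(x)=\mathrm{conv}\{\lim_k\nabla f(x_k): x_k\to x,\ f \text{ differentiable at each } x_k\}$ (over all sequences for which the limit exists). Outer Clarke subdifferential of $\Phi_\lambda$: $\widehat{\partial}\Phi_\lambda(x)=\lambda\,\partial^C(d_1^2)(x)+(1-\lambda)\,\partial^C(d_2^2)(x)$ (Minkowski sum). $\mathrm{Crit}(\Phi_\lambda)=\{x:0\in\partial^C\Phi_\lambda(x)\}$, $\mathrm{Crit}_{\mathrm{out}}(\Phi_\lambda)=\{x:0\in\widehat{\partial}\Phi_\lambda(x)\}$, and $\mathrm{Min}(\Phi_\lambda)$ is the set of local minimizers of $\Phi_\lambda$ in $\mathbb{R}^d$. $\omega_\tau(Y)=\{y^\ast\in\mathbb{R}^d:\exists\,\tau_n\to\infty\text{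 with }Y_{\tau_n}\to y^\ast\}$. *)

theory Defs
  imports "HOL-Probability.Probability"
begin

definition finite_dirac_mixture :: "'a::euclidean_space measure \<Rightarrow> bool" where
  "finite_dirac_mixture \<mu> \<longleftrightarrow>
     sets \<mu> = sets borel \<and>
     (\<exists>(n::nat) (w :: nat \<Rightarrow> real) (a :: nat \<Rightarrow> 'a).
        1 \<le> n \<and> (\<forall>k\<in>{1..n}. 0 < w k) \<and> (\<Sum>k=1..n. w k) = 1 \<and>
        (\<forall>B\<in>sets borel.
           emeasure \<mu> B = (\<Sum>k=1..n. ennreal (w k) * emeasure (return borel (a k)) B)))"

definition measure_support :: "'a::topological_space measure \<Rightarrow> 'a set" where
  "measure_support \<mu> = {x. \<forall>U. open U \<longrightarrow> x \<in> U \<longrightarrow> 0 < emeasure \<mu> U}"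

definition heat_kernel :: "real \<Rightarrow> 'a::euclidean_space \<Rightarrow> real" where
  "heat_kernel t z = (4 * pi * t) powr (- (real DIM('a) / 2)) * exp (- ((norm z)\<^sup>2 / (4 * t)))"

(* the convolution of the function heat_kernel t with the measure \<mu> *)
definition heat_flow :: "'a::euclidean_space measure \<Rightarrow> 'a \<Rightarrow> real \<Rightarrow> real" where
  "heat_flow \<mu> x t = (\<integral>y. heat_kernel t (x - y) \<partial>\<mu>)"

definition heat_potential ::
    "real \<Rightarrow> 'a::euclidean_space measure \<Rightarrow> 'a measure \<Rightarrow> 'a \<Rightarrow> real \<Rightarrow> real" where
  "heat_potential l \<mu>1 \<mu>2 x t = l * ln (heat_flow \<mu>1 x t) + (1 - l) * ln (heat_flow \<mu>2 x t)"

(* unspecified at points where f is not differentiable *)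
definition grad :: "('a::euclidean_space \<Rightarrow> real) \<Rightarrow> 'a \<Rightarrow> 'a" where
  "grad f x = (THE D. GDERIV f x :> D)"

definition geom_potential ::
    "real \<Rightarrow> 'a::euclidean_space set \<Rightarrow> 'a set \<Rightarrow> 'a \<Rightarrow> real" where
  "geom_potential l A1 A2 x = l * (infdist x A1)\<^sup>2 + (1 - l) * (infdist x A2)\<^sup>2"

(* meaningful for locally Lipschitz f, as are all functions it is applied to here *)
definition clarke_subdiff :: "('a::euclidean_space \<Rightarrow> real) \<Rightarrow> 'a \<Rightarrow> 'a set" where
  "clarke_subdiff f x =
     convex hull {p. \<exists>s :: nat \<Rightarrow> 'a. s \<longlonglongrightarrow> x \<and> (\<forall>k. f differentiable (at (s k))) \<and>
                       (\<lambda>k. grad f (s k)) \<longlonglongrightarrow> p}"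

definition outer_clarke_subdiff ::
    "real \<Rightarrow> 'a::euclidean_space set \<Rightarrow> 'a set \<Rightarrow> 'a \<Rightarrow> 'a set" where
  "outer_clarke_subdiff l A1 A2 x =
     {l *\<^sub>R p + (1 - l) *\<^sub>R q | p q.
        p \<in> clarke_subdiff (\<lambda>y. (infdist y A1)\<^sup>2) x \<and>
        q \<in> clarke_subdiff (\<lambda>y. (infdist y A2)\<^sup>2) x}"

definition clarke_crit :: "('a::euclidean_space \<Rightarrow> real) \<Rightarrow> 'a set" where
  "clarke_crit f = {x. 0 \<in> clarke_subdiff f x}"

definition outer_crit :: "real \<Rightarrow> 'a::euclidean_space set \<Rightarrow> 'a set \<Rightarrow> 'a set" where
  "outer_crit l A1 A2 = {x. 0 \<in> outer_clarke_subdiff l A1 A2 x}"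

definition local_minimizers :: "('a::topological_space \<Rightarrow> real) \<Rightarrow> 'a set" where
  "local_minimizers f = {x. \<forall>\<^sub>F y in nhds x. f x \<le> f y}"

definition omega_limit :: "(real \<Rightarrow> 'a::topological_space) \<Rightarrow> 'a set" where
  "omega_limit Y = {y. \<exists>\<tau> :: nat \<Rightarrow> real. filterlim \<tau> at_top sequentially \<and> (\<lambda>n. Y (\<tau> n)) \<longlonglongrightarrow> y}"

lemma grad_eqI:
  assumes "GDERIV f x :> D"
  shows "grad f x = D"
  unfolding grad_def
proof (rule the_equality)
  fix E assume "GDERIV f x :> E"
  with assms have "(\<lambda>h. h \<bullet> D) = (\<lambda>h. h \<bullet> E)"
    unfolding gderiv_def by (rule has_derivative_unique)
  then have "\<forall>h. h \<bullet> D = h \<bullet> E" by (simp add: fun_eq_iff)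
  then show "E = D" by (simp only: vector_eq_ldot)
qed (fact assms)

lemma GDERIV_grad:
  assumes "f differentiable (at x)"
  shows "GDERIV f x :> grad f x"
proof -
  from assms obtain f' where f': "(f has_derivative f') (at x)"
    by (auto simp: differentiable_def)
  then interpret bounded_linear f' by (rule has_derivative_bounded_linear)
  have "f' h = h \<bullet> (\<Sum>b\<in>Basis. f' b *\<^sub>R b)" for h
  proof -
    have "f' h = f' (\<Sum>b\<in>Basis. (h \<bullet> b) *\<^sub>R b)" by (simp add: euclidean_representation)
    also have "\<dots> = h \<bullet> (\<Sum>b\<in>Basis. f' b *\<^sub>R b)"
      by (simp add: sum scaleR inner_sum_right mult.commute)
    finally show ?thesis .
  qed
  then have "f' = (\<lambda>h. h \<bullet> (\<Sum>b\<in>Basis. f' b *\<^sub>R b))" by blast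
  with f' have "GDERIV f x :> (\<Sum>b\<in>Basis. f' b *\<^sub>R b)"
    unfolding gderiv_def by metis
  then show ?thesis using grad_eqI by metis
qed

lemma measure_support_dirac_mixture:
  fixes \<mu> :: "'a::euclidean_space measure" and n :: nat
  assumes "\<And>k. k \<in> {1..n} \<Longrightarrow> 0 < w k"
    and "\<And>B. B \<in> sets borel \<Longrightarrow>
      emeasure \<mu> B = (\<Sum>k=1..n. ennreal (w k) * emeasure (return borel (a k)) B)"
  shows "measure_support \<mu> = a ` {1..n}"
proof -
  have pos: "0 < emeasure \<mu> U \<longleftrightarrow> (\<exists>k\<in>{1..n}. a k \<in> U)" if "open U" for U
  proof -
    have "emeasure \<mu> U = (\<Sum>k=1..n. ennreal (w k) * indicator U (a k))"
      using that by (subst assms(2)) (auto intro!: sum.cong)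
    then have "emeasure \<mu> U = 0 \<longleftrightarrow> (\<forall>k\<in>{1..n}. ennreal (w k) * indicator U (a k) = 0)"
      by (simp only: sum_eq_0_iff[OF finite_atLeastAtMost])
    also have "\<dots> \<longleftrightarrow> (\<forall>k\<in>{1..n}. a k \<notin> U)"
      using assms(1) by (auto simp: indicator_def ennreal_eq_0_iff not_le[symmetric])
    finally have "emeasure \<mu> U = 0 \<longleftrightarrow> (\<forall>k\<in>{1..n}. a k \<notin> U)" .
    then show ?thesis by (auto simp: zero_less_iff_neq_zero)
  qed
  have "closed (a ` {1..n})" by (intro finite_imp_closed) simp
  then have "open (- (a ` {1..n}))" by blast
  with pos have "x \<in> measure_support \<mu> \<Longrightarrow> x \<in> a ` {1..n}" for x
    unfolding measure_support_def by blast
  moreover have "x \<in> a ` {1..n} \<Longrightarrow> x \<in> measure_support \<mu>" for x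
    using pos unfolding measure_support_def by blast
  ultimately show ?thesis by blast
qed

end

theory Submission
  imports Defs
begin

text \<open>In logarithmic time the equation reads \<open>Y' = - (Y - m) / 2\<close>, where \<open>m\<close> is the combination
  with coefficients \<open>l\<close> and \<open>1 - l\<close> of the barycenters of the two supports under the Gibbs weights
  \<open>w\<^sub>k exp (- \<bar>x - a\<^sub>k\<bar>\<^sup>2 / s)\<close> at temperature \<open>s = 4 T exp (- \<tau>)\<close>. The free energy
  \<open>- s ln (\<Sum>k. w\<^sub>k exp (- \<bar>x - a\<^sub>k\<bar>\<^sup>2 / s))\<close>, combined with the same coefficients, decreases at
  rate \<open>4 \<bar>Y'\<bar>\<^sup>2\<close> up to an integrable error, because its temperature derivative is a bounded relative
  entropy. Hence \<open>Y\<close> has arbitrarily small speed at late times near each of its limit points \<open>y\<close>, and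
  as \<open>s\<close> tends to \<open>0\<close> the barycenters approach the convex hulls of the points nearest to \<open>y\<close>. So \<open>y\<close> is
  critical, and by assumption a local minimizer. Since the potential is a paraboloid on each of the
  finitely many cells, there are only finitely many local minimizers, and a bounded continuous curve
  with finitely many limit points converges.\<close>

section \<open>Cells and local minimizers of the geometric potential\<close>

definition nearest :: "'a::real_normed_vector set \<Rightarrow> 'a \<Rightarrow> 'a set" where
  "nearest A x = {a \<in> A. \<forall>b\<in>A. norm (x - a) \<le> norm (x - b)}"

lemma nearest_nonempty:
  assumes "finite A" "A \<noteq> {}"
  shows "nearest A x \<noteq> {}"
  using arg_min_if_finite[OF assms, of "\<lambda>a. norm (x - a)"]
  by (force simp: nearest_def not_less intro: linorder_class.leI)

lemma infdist_nearest:
  assumes "a \<in> nearest A x"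
  shows "infdist x A = norm (x - a)"
proof (rule antisym)
  show "infdist x A \<le> norm (x - a)"
    using assms by (auto simp: nearest_def dist_norm[symmetric] intro: infdist_le)
  have "A \<noteq> {}" using assms by (auto simp: nearest_def)
  then show "norm (x - a) \<le> infdist x A"
    using assms by (auto simp: infdist_notempty nearest_def dist_norm intro!: cINF_greatest)
qed

text \<open>Squaring both norms cancels the terms quadratic in \<open>x\<close>, so a Voronoi cell
  is an intersection of half-spaces.\<close>

lemma convex_nearest_cell: "convex {x::'a::real_inner. a \<in> nearest A x}"
proof -
  have *: "norm (x - a) \<le> norm (x - b) \<longleftrightarrow> (2 *\<^sub>R (b - a)) \<bullet> x \<le> b \<bullet> b - a \<bullet> a" for x b :: 'a
    by (simp add: norm_le inner_diff inner_commute algebra_simps)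
  have "{x::'a. a \<in> nearest A x} =
      (if a \<in> A then \<Inter>b\<in>A. {x. (2 *\<^sub>R (b - a)) \<bullet> x \<le> b \<bullet> b - a \<bullet> a} else {})"
    by (auto simp: nearest_def *)
  moreover have "convex \<dots>" by (cases "a \<in> A") (simp_all only: if_True if_False convex_INT convex_halfspace_le convex_empty)
  ultimately show ?thesis by simp
qed

text \<open>Completing the square. Since the coefficients sum to 1, the leading term is
  \<open>(norm x)\<^sup>2\<close> whatever the sign of \<open>1 - l\<close>, so the potential is an
  upward paraboloid on each cell for \<open>l > 1\<close> as well.\<close>

lemma norm_sq_combination:
  fixes x a b :: "'a::real_inner"
  shows "l * (norm (x - a))\<^sup>2 + (1 - l) * (norm (x - b))\<^sup>2 =
    (norm (x - (l *\<^sub>R a + (1 - l) *\<^sub>R b)))\<^sup>2 +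
    (l * (norm a)\<^sup>2 + (1 - l) * (norm b)\<^sup>2 - (norm (l *\<^sub>R a + (1 - l) *\<^sub>R b))\<^sup>2)"
  by (simp add: power2_norm_eq_inner inner_diff inner_add inner_commute algebra_simps)

text \<open>One-sided first variation: the increment along \<open>w\<close> is divided by
  \<open>\<theta>\<close>, which then falls to 0. Agreement with the paraboloid is asked on the
  segment alone, so that \<open>y\<close> may lie on the boundary of a cell.\<close>

lemma local_minimizer_variation:
  fixes y c w :: "'a::real_inner"
  assumes "y \<in> local_minimizers f"
    and "\<And>\<theta>. 0 \<le> \<theta> \<Longrightarrow> \<theta> \<le> 1 \<Longrightarrow> f (y + \<theta> *\<^sub>R w) = (norm (y + \<theta> *\<^sub>R w - c))\<^sup>2 + \<beta>"
  shows "0 \<le> w \<bullet> (y - c)"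
proof -
  have lim: "((\<lambda>\<theta>. y + \<theta> *\<^sub>R w) \<longlongrightarrow> y) (at_right 0)"
    by (rule tendsto_eq_intros refl | simp)+
  have "\<forall>\<^sub>F x in nhds y. f y \<le> f x" using assms(1) by (simp add: local_minimizers_def)
  then have "\<forall>\<^sub>F \<theta> in at_right 0. f y \<le> f (y + \<theta> *\<^sub>R w)"
    using lim by (auto simp: filterlim_iff)
  moreover have "\<forall>\<^sub>F \<theta> in at_right (0::real). 0 < \<theta> \<and> \<theta> < 1"
    by (auto simp: eventually_at_right_field intro: exI[of _ 1])
  ultimately have "\<forall>\<^sub>F \<theta> in at_right 0. 0 \<le> 2 * (w \<bullet> (y - c)) + \<theta> * (w \<bullet> w)"
  proof eventually_elim
    case (elim \<theta>)
    have "f y = (norm (y - c))\<^sup>2 + \<beta>" using assms(2)[of 0] by simp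
    moreover have "f (y + \<theta> *\<^sub>R w) = (norm (y + \<theta> *\<^sub>R w - c))\<^sup>2 + \<beta>"
      using assms(2)[of \<theta>] elim by simp
    ultimately have "(norm (y - c))\<^sup>2 \<le> (norm (y + \<theta> *\<^sub>R w - c))\<^sup>2" using elim by simp
    then have "0 \<le> \<theta> * (2 * (w \<bullet> (y - c)) + \<theta> * (w \<bullet> w))"
      by (simp add: power2_norm_eq_inner inner_diff inner_add inner_commute algebra_simps)
    then show ?case using elim by (simp add: zero_le_mult_iff)
  qed
  moreover have "((\<lambda>\<theta>. 2 * (w \<bullet> (y - c)) + \<theta> * (w \<bullet> w)) \<longlongrightarrow> 2 * (w \<bullet> (y - c))) (at_right 0)"
    by (rule tendsto_eq_intros refl | simp)+
  ultimately have "0 \<le> 2 * (w \<bullet> (y - c))"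
    by (intro tendsto_lowerbound) auto
  then show ?thesis by simp
qed

lemma geom_potential_cell:
  assumes "a \<in> nearest A1 x" "b \<in> nearest A2 x"
  shows "geom_potential l A1 A2 x = l * (norm (x - a))\<^sup>2 + (1 - l) * (norm (x - b))\<^sup>2"
  using assms by (simp add: geom_potential_def infdist_nearest)

text \<open>Each Voronoi cell carries at most one local minimizer, since the potential is a paraboloid
  on it.\<close>
lemma finite_local_minimizers_geom_potential:
  fixes A1 A2 :: "'a::euclidean_space set"
  assumes "finite A1" "A1 \<noteq> {}" "finite A2" "A2 \<noteq> {}"
  shows "finite (local_minimizers (geom_potential l A1 A2))"
proof -
  \<comment> \<open>Each point gets one pair of nearest points as its label. There are at most
    \<open>card A1 * card A2\<close> labels, so injectivity on the local minimizers
    suffices.\<close>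
  define ab where "ab x = (SOME p. fst p \<in> nearest A1 x \<and> snd p \<in> nearest A2 x)" for x
  have ab: "fst (ab x) \<in> nearest A1 x" "snd (ab x) \<in> nearest A2 x" for x
  proof -
    have "\<exists>p. fst p \<in> nearest A1 x \<and> snd p \<in> nearest A2 x"
      using nearest_nonempty[of A1 x] nearest_nonempty[of A2 x] assms by auto
    then have "fst (ab x) \<in> nearest A1 x \<and> snd (ab x) \<in> nearest A2 x"
      unfolding ab_def by (rule someI_ex)
    then show "fst (ab x) \<in> nearest A1 x" "snd (ab x) \<in> nearest A2 x" by auto
  qed
  let ?f = "geom_potential l A1 A2"
  have var: "0 \<le> (z - y) \<bullet> (y - (l *\<^sub>R a + (1 - l) *\<^sub>R b))"
    if y: "y \<in> local_minimizers ?f"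
      and *: "a \<in> nearest A1 y" "b \<in> nearest A2 y" "a \<in> nearest A1 z" "b \<in> nearest A2 z" for y z a b
  proof (rule local_minimizer_variation[OF y])
    fix \<theta> :: real assume th: "0 \<le> \<theta>" "\<theta> \<le> 1"
    have eq: "y + \<theta> *\<^sub>R (z - y) = (1 - \<theta>) *\<^sub>R y + \<theta> *\<^sub>R z" by (simp add: algebra_simps)
    have "a \<in> nearest A1 (y + \<theta> *\<^sub>R (z - y))" "b \<in> nearest A2 (y + \<theta> *\<^sub>R (z - y))"
      using convexD_alt[OF convex_nearest_cell[of a A1], of y z \<theta>]
        convexD_alt[OF convex_nearest_cell[of b A2], of y z \<theta>] * th by (auto simp: eq)
    then show "?f (y + \<theta> *\<^sub>R (z - y)) =
      (norm (y + \<theta> *\<^sub>R (z - y) - (l *\<^sub>R a + (1 - l) *\<^sub>R b)))\<^sup>2 +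
      (l * (norm a)\<^sup>2 + (1 - l) * (norm b)\<^sup>2 - (norm (l *\<^sub>R a + (1 - l) *\<^sub>R b))\<^sup>2)"
      by (simp only: geom_potential_cell norm_sq_combination)
  qed
  have "inj_on ab (local_minimizers ?f)"
  proof (rule inj_onI)
    fix y z assume y: "y \<in> local_minimizers ?f" and z: "z \<in> local_minimizers ?f" and eq: "ab y = ab z"
    obtain a b where p: "ab y = (a, b)" by (cases "ab y")
    have *: "a \<in> nearest A1 y" "b \<in> nearest A2 y" "a \<in> nearest A1 z" "b \<in> nearest A2 z"
      using ab[of y] ab[of z] p eq by auto
    \<comment> \<open>Adding the variation of \<open>y\<close> towards \<open>z\<close> to that of
      \<open>z\<close> towards \<open>y\<close> removes the common centre and leaves minus the
      squared distance.\<close>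
    have "0 \<le> (z - y) \<bullet> (y - (l *\<^sub>R a + (1 - l) *\<^sub>R b)) + (y - z) \<bullet> (z - (l *\<^sub>R a + (1 - l) *\<^sub>R b))"
      using var[OF y *(1-4)] var[OF z *(3,4,1,2)] by simp
    also have "\<dots> = - ((z - y) \<bullet> (z - y))" by (simp add: inner_diff inner_commute algebra_simps)
    finally have "(z - y) \<bullet> (z - y) \<le> 0" by simp
    then have "z - y = 0" by (metis inner_gt_zero_iff not_less)
    then show "y = z" by simp
  qed
  moreover have "ab ` local_minimizers ?f \<subseteq> A1 \<times> A2"
    using ab unfolding nearest_def mem_Times_iff image_subset_iff by blast
  ultimately show ?thesis using assms by (meson finite_SigmaI finite_subset inj_on_finite)
qed

section \<open>Clarke subdifferentials of minima of paraboloids\<close>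

lemma GDERIV_paraboloid: "GDERIV (\<lambda>x. (norm (x - c))\<^sup>2 + \<beta>) x :> 2 *\<^sub>R (x - c)"
  unfolding gderiv_def power2_norm_eq_inner
  by (rule derivative_eq_intros refl | simp add: fun_eq_iff inner_commute)+

lemma GDERIV_transform_eventually:
  assumes "GDERIV g x :> D" "\<forall>\<^sub>F z in nhds x. f z = g z"
  shows "GDERIV f x :> D"
proof -
  have "\<forall>\<^sub>F z in at x. g z = f z"
    using assms(2) by (auto simp: eventually_at_filter elim: eventually_mono)
  moreover have "g x = f x" using eventually_nhds_x_imp_x[OF assms(2)] by simp
  ultimately show ?thesis
    using assms(1) has_derivative_transform_eventually unfolding gderiv_def by blast
qed

lemma GDERIV_imp_differentiable: "GDERIV f x :> D \<Longrightarrow> f differentiable (at x)"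
  by (auto simp: gderiv_def differentiable_def)

text \<open>Only the slopes that are extreme in the hull of the active ones need be limits of gradients;
  an extreme point of a polytope is exposed, and the corresponding paraboloid is the unique minimal
  one along the exposing direction.\<close>
lemma clarke_subdiff_min_paraboloids:
  fixes f :: "'a::euclidean_space \<Rightarrow> real" and c :: "'i \<Rightarrow> 'a"
  assumes fin: "finite I"
    and le: "\<And>x i. i \<in> I \<Longrightarrow> f x \<le> (norm (x - c i))\<^sup>2 + \<beta> i"
    and att: "\<And>x. \<exists>i\<in>I. f x = (norm (x - c i))\<^sup>2 + \<beta> i"
    and q: "q \<in> convex hull (c ` {i\<in>I. f y = (norm (y - c i))\<^sup>2 + \<beta> i})"
  shows "2 *\<^sub>R (y - q) \<in> clarke_subdiff f y"
proof -
  define g where "g i x = (norm (x - c i))\<^sup>2 + \<beta> i" for i x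
  define J where "J = {i\<in>I. f y = g i y}"
  define S where "S = c ` J"
  define P where "P = {p. \<exists>s :: nat \<Rightarrow> 'a. s \<longlonglongrightarrow> y \<and> (\<forall>k. f differentiable (at (s k))) \<and>
                       (\<lambda>k. grad f (s k)) \<longlonglongrightarrow> p}"
  have finS: "finite S" using fin by (simp add: S_def J_def)
  have contg: "continuous_on UNIV (g i)" for i
    unfolding g_def by (intro continuous_intros)
  have ext: "2 *\<^sub>R (y - e) \<in> P" if e: "e extreme_point_of (convex hull S)" for e
  proof -
    have "{e} face_of (convex hull S)" using e by (simp add: face_of_singleton)
    then have "{e} exposed_face_of (convex hull S)"
      using exposed_face_of_polyhedron polytope_imp_polyhedron polytope_convex_hull finS by blast
    then obtain v b where vb: "convex hull S \<subseteq> {x. v \<bullet> x \<le> b}" "{e} = convex hull S \<inter> {x. v \<bullet> x = b}"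
      unfolding exposed_face_of_def by auto
    have eb: "v \<bullet> e = b" using vb(2) by auto
    have lt: "v \<bullet> x < v \<bullet> e" if "x \<in> S" "x \<noteq> e" for x
    proof -
      have "x \<in> convex hull S" using that by (simp add: hull_inc)
      then have "v \<bullet> x \<le> b" "v \<bullet> x \<noteq> b" using vb that by auto
      then show ?thesis using eb by simp
    qed
    have "e \<in> S" using e by (rule extreme_point_of_convex_hull)
    then obtain j where j: "j \<in> J" "c j = e" by (auto simp: S_def)
    \<comment> \<open>Several indices may carry the same paraboloid. Those that coincide with
      \<open>g j\<close> are excluded, as no strict inequality can separate them from it.\<close>
    define I' where "I' = {i\<in>I. g i \<noteq> g j}"
    have ev: "\<forall>\<^sub>F \<epsilon> in at_right 0. \<forall>i\<in>I'. g j (y + \<epsilon> *\<^sub>R v) < g i (y + \<epsilon> *\<^sub>R v)"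
    proof (rule eventually_ball_finite)
      show "finite I'" using fin by (simp add: I'_def)
      show "\<forall>i\<in>I'. \<forall>\<^sub>F \<epsilon> in at_right 0. g j (y + \<epsilon> *\<^sub>R v) < g i (y + \<epsilon> *\<^sub>R v)"
      proof
        fix i assume i: "i \<in> I'"
        show "\<forall>\<^sub>F \<epsilon> in at_right 0. g j (y + \<epsilon> *\<^sub>R v) < g i (y + \<epsilon> *\<^sub>R v)"
        proof (cases "i \<in> J")
          case True
          have gy: "g i y = g j y" using True j by (simp add: J_def)
          have ne: "c i \<noteq> e"
          proof
            assume "c i = e"
            with gy j(2) have "\<beta> i = \<beta> j" by (simp add: g_def)
            with \<open>c i = e\<close> j(2) have "g i = g j" by (simp add: g_def fun_eq_iff)
            then show False using i by (simp add: I'_def)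
          qed
          have pos: "0 < v \<bullet> e - v \<bullet> c i" using lt[of "c i"] True ne by (simp add: S_def)
          \<comment> \<open>The leading terms agree, so the difference of two paraboloids is affine
            along the ray. Its slope is positive because \<open>v\<close> exposes
            \<open>e\<close>.\<close>
          have "g i (y + \<epsilon> *\<^sub>R v) - g j (y + \<epsilon> *\<^sub>R v) = g i y - g j y + 2 * \<epsilon> * (v \<bullet> e - v \<bullet> c i)" for \<epsilon>
            unfolding g_def j(2)
            by (simp add: power2_norm_eq_inner inner_diff inner_add inner_commute algebra_simps)
          then have *: "g i (y + \<epsilon> *\<^sub>R v) - g j (y + \<epsilon> *\<^sub>R v) = 2 * \<epsilon> * (v \<bullet> e - v \<bullet> c i)" for \<epsilon>
            using gy by simp
          have "g j (y + \<epsilon> *\<^sub>R v) < g i (y + \<epsilon> *\<^sub>R v)" if "\<epsilon> > 0" for \<epsilon>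
          proof -
            have "0 < 2 * \<epsilon> * (v \<bullet> e - v \<bullet> c i)" using that pos by simp
            then show ?thesis using *[of \<epsilon>] by linarith
          qed
          then show ?thesis by (auto simp: eventually_at_right_field intro: exI[of _ 1])
        next
          case False
          have "f y \<le> g i y" "f y \<noteq> g i y" "f y = g j y"
            using False i le[of i y] j(1) by (auto simp: J_def I'_def g_def)
          then have less: "g j y < g i y" by simp
          have lim: "((\<lambda>\<epsilon>. y + \<epsilon> *\<^sub>R v) \<longlongrightarrow> y) (at_right 0)"
            by (rule tendsto_eq_intros refl | simp)+
          have "((\<lambda>\<epsilon>. g k (y + \<epsilon> *\<^sub>R v)) \<longlongrightarrow> g k y) (at_right 0)" for k
            using continuous_on_tendsto_compose[OF contg lim] by simp
          then have "((\<lambda>\<epsilon>. g i (y + \<epsilon> *\<^sub>R v) - g j (y + \<epsilon> *\<^sub>R v)) \<longlongrightarrow> g i y - g j y) (at_right 0)"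
            by (intro tendsto_diff)
          from order_tendstoD(1)[OF this, of 0] less show ?thesis by simp
        qed
      qed
    qed
    have grd: "GDERIV f x :> 2 *\<^sub>R (x - e)" if x: "\<forall>i\<in>I'. g j x < g i x" for x
    proof (rule GDERIV_transform_eventually)
      show "GDERIV (g j) x :> 2 *\<^sub>R (x - e)"
        using GDERIV_paraboloid[of e "\<beta> j" x] j(2) by (simp add: g_def[abs_def])
      have "open {z. g j z < g i z}" for i
        by (intro open_Collect_less contg)
      then have "\<forall>i\<in>I'. \<forall>\<^sub>F z in nhds x. g j z < g i z"
        using x by (auto simp: eventually_nhds)
      then have "\<forall>\<^sub>F z in nhds x. \<forall>i\<in>I'. g j z < g i z"
        using fin by (intro eventually_ball_finite) (auto simp: I'_def)
      then show "\<forall>\<^sub>F z in nhds x. f z = g j z"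
      proof eventually_elim
        case (elim z)
        obtain i where i: "i \<in> I" "f z = g i z" using att[of z] by (auto simp: g_def)
        have jI: "j \<in> I" using j by (simp add: J_def)
        show ?case
        proof (cases "i \<in> I'")
          case True
          with elim i le[OF jI, of z] show ?thesis by (force simp: g_def)
        next
          case False
          with i show ?thesis by (simp add: I'_def)
        qed
      qed
    qed
    have "\<forall>\<^sub>F n in sequentially. \<forall>i\<in>I'.
        g j (y + inverse (real (Suc n)) *\<^sub>R v) < g i (y + inverse (real (Suc n)) *\<^sub>R v)"
    proof -
      have "filterlim (\<lambda>n. inverse (real (Suc n))) (at_right 0) sequentially"
        using LIMSEQ_inverse_real_of_nat by (auto simp: filterlim_at simp del: of_nat_Suc)
      then show ?thesis using ev by (rule eventually_compose_filterlim[rotated])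
    qed
    then obtain N where N: "\<And>n. n \<ge> N \<Longrightarrow> \<forall>i\<in>I'.
        g j (y + inverse (real (Suc n)) *\<^sub>R v) < g i (y + inverse (real (Suc n)) *\<^sub>R v)"
      by (auto simp: eventually_sequentially)
    \<comment> \<open>The Clarke subdifferential asks for differentiability at every term of the
      sequence, hence the shift by \<open>N\<close>.\<close>
    define s where "s n = y + inverse (real (Suc (n + N))) *\<^sub>R v" for n
    have "(\<lambda>n. y + inverse (real (Suc n)) *\<^sub>R v) \<longlonglongrightarrow> y + 0 *\<^sub>R v"
      by (intro tendsto_intros LIMSEQ_inverse_real_of_nat)
    then have s: "s \<longlonglongrightarrow> y" unfolding s_def by (intro LIMSEQ_ignore_initial_segment) simp
    have gs: "GDERIV f (s n) :> 2 *\<^sub>R (s n - e)" for n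
      using grd[of "s n"] N[of "n + N"] by (simp add: s_def)
    have "(\<lambda>n. grad f (s n)) \<longlonglongrightarrow> 2 *\<^sub>R (y - e)"
      unfolding grad_eqI[OF gs] by (intro tendsto_intros s)
    then show ?thesis using s gs GDERIV_imp_differentiable unfolding P_def by blast
  qed
  \<comment> \<open>The map from centres to gradients is affine and commutes with convex hulls; by
    Krein-Milman the hull of the centres is generated by its extreme points, where
    \<open>ext\<close> applies.\<close>
  have "2 *\<^sub>R (y - q) \<in> (\<lambda>x. 2 *\<^sub>R y + (- 2) *\<^sub>R x) ` (convex hull S)"
    using q by (auto simp: S_def J_def g_def algebra_simps)
  also have "convex hull S = convex hull {e. e extreme_point_of (convex hull S)}"
    by (intro Krein_Milman_Minkowski finite_imp_compact_convex_hull finS convex_convex_hull)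
  also have "(\<lambda>x. 2 *\<^sub>R y + (- 2) *\<^sub>R x) ` (convex hull {e. e extreme_point_of (convex hull S)}) =
      convex hull ((\<lambda>x. 2 *\<^sub>R y + (- 2) *\<^sub>R x) ` {e. e extreme_point_of (convex hull S)})"
    by (rule convex_hull_affinity[symmetric])
  also have "\<dots> \<subseteq> convex hull P"
    using ext by (intro hull_mono) (auto simp: algebra_simps)
  finally show ?thesis by (simp add: clarke_subdiff_def P_def)
qed

lemma infdist_sq_le:
  "a \<in> A \<Longrightarrow> (infdist x A)\<^sup>2 \<le> (norm (x - a))\<^sup>2"
  by (auto simp: dist_norm[symmetric] intro: infdist_le power_mono infdist_nonneg)

text \<open>The squared distance is the minimum of the paraboloids centred at the points of
  \<open>A\<close> with zero offset, and those active at \<open>y\<close> belong to its nearest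
  points.\<close>

lemma clarke_subdiff_infdist_sq:
  fixes A :: "'a::euclidean_space set"
  assumes "finite A" "A \<noteq> {}" "q \<in> convex hull (nearest A y)"
  shows "2 *\<^sub>R (y - q) \<in> clarke_subdiff (\<lambda>x. (infdist x A)\<^sup>2) y"
proof (rule clarke_subdiff_min_paraboloids[of A _ id "\<lambda>_. 0"])
  have sub: "nearest A y \<subseteq> {a \<in> A. (infdist y A)\<^sup>2 = (norm (y - a))\<^sup>2}"
    using infdist_nearest[of _ A y] by (auto simp: nearest_def)
  then show "q \<in> convex hull (id ` {i \<in> A. (infdist y A)\<^sup>2 = (norm (y - id i))\<^sup>2 + 0})"
    using hull_mono[OF sub, of convex] assms by auto
  show "\<exists>a\<in>A. (infdist x A)\<^sup>2 = (norm (x - id a))\<^sup>2 + 0" for x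
    using nearest_nonempty[OF assms(1,2), of x] infdist_nearest[of _ A x]
    by (auto simp: nearest_def)
qed (use assms infdist_sq_le in auto)

text \<open>Convex hulls commute with products and with linear maps.\<close>

lemma convex_hull_combination:
  fixes p q :: "'a::real_vector"
  assumes "p \<in> convex hull M" "q \<in> convex hull N"
  shows "l *\<^sub>R p + (1 - l) *\<^sub>R q \<in> convex hull ((\<lambda>(a, b). l *\<^sub>R a + (1 - l) *\<^sub>R b) ` (M \<times> N))"
proof -
  let ?f = "\<lambda>(a, b). l *\<^sub>R a + (1 - l) *\<^sub>R b :: 'a"
  have "linear ?f" by (auto simp: linear_iff algebra_simps)
  then have "convex hull (?f ` (M \<times> N)) = ?f ` ((convex hull M) \<times> (convex hull N))"
    by (simp only: convex_hull_linear_image[symmetric] convex_hull_Times)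
  then show ?thesis using assms by force
qed

text \<open>With both coefficients nonnegative the potential is the minimum, over all pairs in
  \<open>A1 \<times> A2\<close>, of the paraboloids from \<open>norm_sq_combination\<close>. For
  \<open>l > 1\<close> the second distance enters with a negative sign and this description as a
  minimum breaks down.\<close>

lemma clarke_subdiff_geom_potential:
  fixes A1 A2 :: "'a::euclidean_space set"
  assumes A: "finite A1" "A1 \<noteq> {}" "finite A2" "A2 \<noteq> {}"
    and l: "0 \<le> l" "l \<le> 1"
    and q: "p \<in> convex hull (nearest A1 y)" "q \<in> convex hull (nearest A2 y)"
  shows "2 *\<^sub>R (y - (l *\<^sub>R p + (1 - l) *\<^sub>R q)) \<in> clarke_subdiff (geom_potential l A1 A2) y"
proof -
  let ?c = "\<lambda>(a, b). l *\<^sub>R a + (1 - l) *\<^sub>R b :: 'a"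
  let ?b = "\<lambda>(a, b). l * (norm a)\<^sup>2 + (1 - l) * (norm b)\<^sup>2 - (norm (l *\<^sub>R a + (1 - l) *\<^sub>R b))\<^sup>2"
  have par: "(norm (x - ?c i))\<^sup>2 + ?b i = l * (norm (x - fst i))\<^sup>2 + (1 - l) * (norm (x - snd i))\<^sup>2" for x i
    by (cases i) (simp only: prod.case fst_conv snd_conv norm_sq_combination)
  have cell: "geom_potential l A1 A2 x = (norm (x - ?c i))\<^sup>2 + ?b i"
    if "i \<in> nearest A1 x \<times> nearest A2 x" for x i
    unfolding par using that by (auto simp: geom_potential_cell)
  show ?thesis
  proof (rule clarke_subdiff_min_paraboloids[of "A1 \<times> A2" _ ?c ?b])
    show "geom_potential l A1 A2 x \<le> (norm (x - ?c i))\<^sup>2 + ?b i" if "i \<in> A1 \<times> A2" for x i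
      unfolding par geom_potential_def using l that
      by (intro add_mono mult_left_mono infdist_sq_le) auto
    show "\<exists>i\<in>A1 \<times> A2. geom_potential l A1 A2 x = (norm (x - ?c i))\<^sup>2 + ?b i" for x
    proof -
      obtain a b where ab: "a \<in> nearest A1 x" "b \<in> nearest A2 x"
        using nearest_nonempty[of A1 x] nearest_nonempty[of A2 x] A by auto
      then have "(a, b) \<in> A1 \<times> A2" by (simp add: nearest_def)
      with cell[of "(a, b)" x] ab show ?thesis by blast
    qed
    have "nearest A1 y \<times> nearest A2 y \<subseteq>
        {i \<in> A1 \<times> A2. geom_potential l A1 A2 y = (norm (y - ?c i))\<^sup>2 + ?b i}"
      using cell[of _ y] by (auto simp: nearest_def)
    then have "convex hull (?c ` (nearest A1 y \<times> nearest A2 y)) \<subseteq> convex hull (?c `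
        {i \<in> A1 \<times> A2. geom_potential l A1 A2 y = (norm (y - ?c i))\<^sup>2 + ?b i})"
      by (intro hull_mono image_mono)
    then show "l *\<^sub>R p + (1 - l) *\<^sub>R q \<in> convex hull (?c `
        {i \<in> A1 \<times> A2. geom_potential l A1 A2 y = (norm (y - ?c i))\<^sup>2 + ?b i})"
      using convex_hull_combination[OF q, of l] by blast
  qed (use A in auto)
qed

section \<open>Limit sets of curves\<close>

text \<open>Bolzano-Weierstrass along the times \<open>\<tau> n\<close>, after dropping those before
  \<open>a\<close>. The closed set \<open>C\<close> is later the whole space or a sphere.\<close>

lemma omega_limit_bounded_nonempty:
  fixes Y :: "real \<Rightarrow> 'a::euclidean_space"
  assumes "bounded (Y ` {a..})" "filterlim \<tau> at_top sequentially"
    and "closed C" "\<And>n. Y (\<tau> n) \<in> C"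
  shows "omega_limit Y \<inter> C \<noteq> {}"
proof -
  have "\<forall>\<^sub>F n in sequentially. \<tau> n \<ge> a"
    using assms(2) by (simp add: filterlim_at_top)
  then obtain N where N: "\<And>n. n \<ge> N \<Longrightarrow> \<tau> n \<ge> a" by (auto simp: eventually_sequentially)
  have "bounded (range (\<lambda>n. Y (\<tau> (n + N))))"
    by (rule bounded_subset[OF assms(1)]) (use N in auto)
  then obtain y r where r: "strict_mono r" "((\<lambda>n. Y (\<tau> (n + N))) \<circ> r) \<longlonglongrightarrow> y"
    using bounded_imp_convergent_subsequence by blast
  have "filterlim (\<lambda>n. \<tau> (r n + N)) at_top sequentially"
    using filterlim_subseq[OF r(1)] assms(2)
    by (intro filterlim_compose[OF assms(2)] filterlim_compose[OF filterlim_add_const_nat_at_top])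
  then have "y \<in> omega_limit Y" using r(2) by (auto simp: omega_limit_def o_def)
  moreover have "y \<in> C" using assms(3,4) r(2)
    by (intro closed_sequentially[of C "((\<lambda>n. Y (\<tau> (n + N))) \<circ> r)" y]) auto
  ultimately show ?thesis by auto
qed

text \<open>If \<open>Y\<close> had a limit point \<open>y\<close> without converging to it, then by the intermediate value
  theorem it would cross every small sphere around \<open>y\<close> at arbitrarily late times, and each of these
  spheres would contain a limit point.\<close>
lemma convergent_if_finite_omega_limit:
  fixes Y :: "real \<Rightarrow> 'a::euclidean_space"
  assumes bdd: "bounded (Y ` {a..})" and cont: "continuous_on {a..} Y"
    and fin: "finite (omega_limit Y)"
  shows "\<exists>y\<in>omega_limit Y. (Y \<longlongrightarrow> y) at_top"
proof -
  have "omega_limit Y \<inter> UNIV \<noteq> {}"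
    by (rule omega_limit_bounded_nonempty[OF bdd filterlim_real_sequentially]) auto
  then obtain y \<tau> where y: "y \<in> omega_limit Y"
    and \<tau>: "filterlim \<tau> at_top sequentially" "(\<lambda>n. Y (\<tau> n)) \<longlonglongrightarrow> y"
    by (auto simp: omega_limit_def)
  have "(Y \<longlongrightarrow> y) at_top"
  proof (rule ccontr)
    assume "\<not> (Y \<longlongrightarrow> y) at_top"
    then obtain \<epsilon> where \<epsilon>: "\<epsilon> > 0" "\<not> (\<forall>\<^sub>F t in at_top. dist (Y t) y < \<epsilon>)"
      by (auto simp: tendsto_iff)
    have late: "\<exists>t\<ge>b. \<epsilon> \<le> dist (Y t) y" for b
      using \<epsilon>(2) by (auto simp: eventually_at_top_linorder not_less)
    have sphere: "omega_limit Y \<inter> sphere y r \<noteq> {}" if r: "0 < r" "r < \<epsilon>" for r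
    proof -
      have "\<exists>t\<ge>b. dist (Y t) y = r" if b: "b \<ge> a" for b
      proof -
        have "\<forall>\<^sub>F n in sequentially. dist (Y (\<tau> n)) y < r" "\<forall>\<^sub>F n in sequentially. \<tau> n \<ge> b"
          using \<tau> r by (auto simp: tendsto_iff filterlim_at_top)
        then have "\<forall>\<^sub>F n in sequentially. dist (Y (\<tau> n)) y < r \<and> \<tau> n \<ge> b"
          by (rule eventually_conj)
        then obtain n where n: "dist (Y (\<tau> n)) y < r" "\<tau> n \<ge> b"
          by (auto dest: eventually_happens)
        obtain t where t: "t \<ge> \<tau> n" "\<epsilon> \<le> dist (Y t) y" using late by blast
        have "continuous_on {\<tau> n..t} (\<lambda>t. dist (Y t) y)"
          by (intro continuous_intros continuous_on_subset[OF cont]) (use n b in auto)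
        then have "\<exists>x\<ge>\<tau> n. x \<le> t \<and> dist (Y x) y = r"
          using n t r by (intro IVT') auto
        then obtain x where "x \<ge> \<tau> n" "dist (Y x) y = r" by blast
        then show ?thesis using n(2) by (intro exI[of _ x]) auto
      qed
      from this[of "max a (real _)"]
      have "\<forall>n. \<exists>t. t \<ge> max a (real n) \<and> Y t \<in> sphere y r"
        by (simp add: dist_commute)
      then obtain \<sigma> where \<sigma>: "\<And>n. \<sigma> n \<ge> max a (real n)" "\<And>n. Y (\<sigma> n) \<in> sphere y r"
        by metis
      have "filterlim \<sigma> at_top sequentially"
        using \<sigma>(1) by (intro filterlim_at_top_mono[OF filterlim_real_sequentially]) auto
      then show ?thesis using bdd \<sigma>(2) by (intro omega_limit_bounded_nonempty) auto
    qed
    \<comment> \<open>The distances from \<open>y\<close> to the finitely many limit points would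
      fill a whole interval.\<close>
    have "{0<..<\<epsilon>} \<subseteq> dist y ` omega_limit Y"
    proof
      fix r assume "r \<in> {0<..<\<epsilon>}"
      then show "r \<in> dist y ` omega_limit Y" using sphere[of r] by auto
    qed
    then have "finite {0<..<\<epsilon>}" using fin by (meson finite_imageI finite_subset)
    then show False using \<epsilon>(1) by (simp add: infinite_Ioo)
  qed
  then show ?thesis using y by blast
qed

section \<open>Gibbs barycenters\<close>

locale weighted_points =
  fixes A :: "'a::euclidean_space set" and v :: "'a \<Rightarrow> real"
  assumes finite_points: "finite A" and points_nonempty: "A \<noteq> {}"
    and weight_pos: "\<And>a. a \<in> A \<Longrightarrow> 0 < v a"
begin

text \<open>At temperature \<open>s = 4 * t\<close> this is the heat flow of the mixture without its
  Gaussian prefactor.\<close>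

definition partition_sum :: "real \<Rightarrow> 'a \<Rightarrow> real" where
  "partition_sum s x = (\<Sum>a\<in>A. v a * exp (- ((norm (x - a))\<^sup>2 / s)))"

definition gibbs :: "real \<Rightarrow> 'a \<Rightarrow> 'a \<Rightarrow> real" where
  "gibbs s x a = v a * exp (- ((norm (x - a))\<^sup>2 / s)) / partition_sum s x"

definition barycenter :: "real \<Rightarrow> 'a \<Rightarrow> 'a" where
  "barycenter s x = (\<Sum>a\<in>A. gibbs s x a *\<^sub>R a)"

lemma partition_sum_pos: "0 < partition_sum s x"
  unfolding partition_sum_def using finite_points points_nonempty weight_pos
  by (intro sum_pos) auto

lemma gibbs_pos: "a \<in> A \<Longrightarrow> 0 < gibbs s x a"
  using weight_pos partition_sum_pos by (simp add: gibbs_def)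

lemma sum_gibbs: "(\<Sum>a\<in>A. gibbs s x a) = 1"
  unfolding gibbs_def sum_divide_distrib[symmetric] partition_sum_def[symmetric]
  using partition_sum_pos[of s x] by simp

lemma gibbs_le_1: "a \<in> A \<Longrightarrow> gibbs s x a \<le> 1"
  using member_le_sum[of a A "gibbs s x"] finite_points gibbs_pos[of _ s x]
  by (auto simp: sum_gibbs less_imp_le)

lemma norm_barycenter_le: "norm (barycenter s x) \<le> (\<Sum>a\<in>A. norm a)"
  unfolding barycenter_def
  by (rule order_trans[OF norm_sum], rule sum_mono)
    (simp add: gibbs_le_1 less_imp_le[OF gibbs_pos] mult_left_le_one_le)

text \<open>Comparison with one strictly nearer point \<open>b\<close>: the weight of
  \<open>a\<close> is at most a constant times \<open>exp (- gap / s)\<close>, where the gap of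
  squared distances stays away from 0 near \<open>y\<close>. A general filter \<open>F\<close>
  allows the limit to be taken along late times close to \<open>y\<close>.\<close>

lemma gibbs_tendsto_0:
  assumes X: "(X \<longlongrightarrow> y) F" and s: "filterlim s (at_right 0) F"
    and a: "a \<in> A" "a \<notin> nearest A y"
  shows "((\<lambda>n. gibbs (s n) (X n) a) \<longlongrightarrow> 0) F"
proof -
  obtain b where b: "b \<in> A" "norm (y - b) < norm (y - a)"
    using a by (auto simp: nearest_def not_le)
  have "(norm (y - b))\<^sup>2 < (norm (y - a))\<^sup>2" using b by (intro power_strict_mono) auto
  moreover have "((\<lambda>n. (norm (X n - a))\<^sup>2 - (norm (X n - b))\<^sup>2) \<longlongrightarrow> (norm (y - a))\<^sup>2 - (norm (y - b))\<^sup>2) F"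
    by (intro tendsto_intros X)
  moreover have "filterlim (\<lambda>n. inverse (s n)) at_top F"
    using s filterlim_compose[OF filterlim_inverse_at_top_right] by blast
  ultimately have "filterlim (\<lambda>n. ((norm (X n - a))\<^sup>2 - (norm (X n - b))\<^sup>2) * inverse (s n)) at_top F"
    by (intro filterlim_tendsto_pos_mult_at_top) auto
  then have "((\<lambda>n. exp (- (((norm (X n - a))\<^sup>2 - (norm (X n - b))\<^sup>2) * inverse (s n)))) \<longlongrightarrow> 0) F"
    by (intro filterlim_compose[OF exp_at_bot]) (simp add: filterlim_uminus_at_bot)
  from tendsto_mult_right_zero[OF this, of "v a / v b"]
  have lim: "((\<lambda>n. v a / v b * exp (- (((norm (X n - a))\<^sup>2 - (norm (X n - b))\<^sup>2) * inverse (s n)))) \<longlongrightarrow> 0) F" .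
  have le: "gibbs t x a \<le> v a / v b * exp (- (((norm (x - a))\<^sup>2 - (norm (x - b))\<^sup>2) * inverse t))" for t x
  proof -
    have "v b * exp (- ((norm (x - b))\<^sup>2 / t)) \<le> partition_sum t x"
      unfolding partition_sum_def using b(1) finite_points weight_pos
      by (intro member_le_sum) (auto simp: less_imp_le)
    then have "gibbs t x a \<le> v a * exp (- ((norm (x - a))\<^sup>2 / t)) / (v b * exp (- ((norm (x - b))\<^sup>2 / t)))"
      unfolding gibbs_def using weight_pos[OF a(1)] weight_pos[OF b(1)]
      by (intro divide_left_mono) (auto intro!: mult_pos_pos partition_sum_pos simp: less_imp_le)
    also have "\<dots> = v a / v b * (exp (- ((norm (x - a))\<^sup>2 / t)) / exp (- ((norm (x - b))\<^sup>2 / t)))"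
      by simp
    also have "\<dots> = v a / v b * exp (- (((norm (x - a))\<^sup>2 - (norm (x - b))\<^sup>2) * inverse t))"
      by (simp only: exp_diff[symmetric]) (simp add: divide_simps)
    finally show ?thesis .
  qed
  show ?thesis
    by (rule tendsto_sandwich[OF _ _ tendsto_const lim])
      (use le gibbs_pos[OF a(1)] in \<open>auto simp: less_imp_le\<close>)
qed

text \<open>Moving the vanishing mass of the points that are not nearest to \<open>y\<close> onto a nearest one turns
  the barycenter into a convex combination of nearest points.\<close>
lemma eventually_barycenter_near_hull:
  assumes X: "(X \<longlongrightarrow> y) F" and s: "filterlim s (at_right 0) F" and "0 < \<epsilon>"
  shows "\<forall>\<^sub>F n in F. \<exists>q \<in> convex hull (nearest A y). norm (barycenter (s n) (X n) - q) < \<epsilon>"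
proof -
  obtain b where b: "b \<in> nearest A y"
    using nearest_nonempty[OF finite_points points_nonempty] by blast
  let ?R = "A - nearest A y"
  have sub: "nearest A y \<subseteq> A" by (auto simp: nearest_def)
  have finN: "finite (nearest A y)" using finite_points sub by (rule finite_subset[rotated])
  define q where "q n = (\<Sum>a\<in>A. gibbs (s n) (X n) a *\<^sub>R (if a \<in> nearest A y then a else b))" for n
  have "q n \<in> convex hull (nearest A y)" for n
    unfolding q_def using finite_points sum_gibbs gibbs_pos b
    by (intro convex_sum convex_convex_hull) (auto intro: hull_inc less_imp_le)
  moreover have "((\<lambda>n. \<Sum>a\<in>?R. gibbs (s n) (X n) a * norm (a - b)) \<longlongrightarrow> 0) F"
    by (intro tendsto_null_sum tendsto_mult_left_zero gibbs_tendsto_0[OF X s]) auto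
  then have "\<forall>\<^sub>F n in F. (\<Sum>a\<in>?R. gibbs (s n) (X n) a * norm (a - b)) < \<epsilon>"
    using \<open>0 < \<epsilon>\<close> by (rule order_tendstoD(2))
  moreover have "norm (barycenter (s n) (X n) - q n) \<le> (\<Sum>a\<in>?R. gibbs (s n) (X n) a * norm (a - b))" for n
  proof -
    have "barycenter (s n) (X n) - q n =
        (\<Sum>a\<in>A. gibbs (s n) (X n) a *\<^sub>R (a - (if a \<in> nearest A y then a else b)))"
      by (simp only: barycenter_def q_def sum_subtractf[symmetric] scaleR_diff_right)
    also have "\<dots> = (\<Sum>a\<in>?R. gibbs (s n) (X n) a *\<^sub>R (a - b))"
      using finite_points by (intro sum.mono_neutral_cong_right) auto
    also have "norm \<dots> \<le> (\<Sum>a\<in>?R. gibbs (s n) (X n) a * norm (a - b))"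
      by (rule order_trans[OF norm_sum], rule sum_mono)
        (simp add: less_imp_le[OF gibbs_pos] abs_of_pos[OF gibbs_pos])
    finally show ?thesis .
  qed
  ultimately show ?thesis
    by (auto elim!: eventually_mono intro: le_less_trans)
qed

section \<open>Free energy of the Gibbs weights: derivatives, entropy and bounds\<close>

lemma barycenter_offset:
  "(\<Sum>a\<in>A. gibbs s x a * ((x - a) \<bullet> h)) = (x - barycenter s x) \<bullet> h"
proof -
  have "(\<Sum>a\<in>A. gibbs s x a * ((x - a) \<bullet> h)) = (\<Sum>a\<in>A. gibbs s x a *\<^sub>R x - gibbs s x a *\<^sub>R a) \<bullet> h"
    by (simp add: inner_sum_left inner_diff_left algebra_simps)
  also have "\<dots> = (x - barycenter s x) \<bullet> h"
    by (simp add: sum_subtractf barycenter_def scaleR_left.sum[symmetric] sum_gibbs)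
  finally show ?thesis .
qed

lemma GDERIV_ln_partition_sum:
  "GDERIV (\<lambda>x. ln (partition_sum s x)) x :> - (2 / s) *\<^sub>R (x - barycenter s x)"
proof -
  have "((\<lambda>x. partition_sum s x) has_derivative
      (\<lambda>h. \<Sum>a\<in>A. v a * (exp (- ((norm (x - a))\<^sup>2 / s)) * (- (2 * ((x - a) \<bullet> h) / s))))) (at x)"
    unfolding partition_sum_def power2_norm_eq_inner
    by (auto intro!: derivative_eq_intros simp: fun_eq_iff inner_commute divide_inverse ac_simps)
  from has_derivative_ln[OF partition_sum_pos this]
  have "((\<lambda>x. ln (partition_sum s x)) has_derivative
      (\<lambda>h. (\<Sum>a\<in>A. v a * (exp (- ((norm (x - a))\<^sup>2 / s)) * (- (2 * ((x - a) \<bullet> h) / s)))) *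
        inverse (partition_sum s x))) (at x)" .
  moreover have "(\<Sum>a\<in>A. v a * (exp (- ((norm (x - a))\<^sup>2 / s)) * (- (2 * ((x - a) \<bullet> h) / s)))) *
        inverse (partition_sum s x) = h \<bullet> (- (2 / s) *\<^sub>R (x - barycenter s x))" for h
  proof -
    have "(\<Sum>a\<in>A. v a * (exp (- ((norm (x - a))\<^sup>2 / s)) * (- (2 * ((x - a) \<bullet> h) / s)))) *
        inverse (partition_sum s x) = (\<Sum>a\<in>A. - (2 / s) * (gibbs s x a * ((x - a) \<bullet> h)))"
      unfolding sum_distrib_right
      by (intro sum.cong refl) (simp add: gibbs_def divide_inverse algebra_simps)
    also have "\<dots> = - (2 / s) * ((x - barycenter s x) \<bullet> h)"
      by (simp only: sum_distrib_left[symmetric] barycenter_offset)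
    finally show ?thesis by (simp add: inner_commute)
  qed
  ultimately show ?thesis unfolding gderiv_def by simp
qed

text \<open>The relative entropy of the Gibbs weights with respect to \<open>v\<close>.\<close>
definition entropy :: "real \<Rightarrow> 'a \<Rightarrow> real" where
  "entropy s x = - ln (partition_sum s x) - (\<Sum>a\<in>A. gibbs s x a * (norm (x - a))\<^sup>2) / s"

text \<open>The entropy is minus the sum of \<open>gibbs * ln (v / gibbs)\<close>. Each summand is
  at most \<open>v\<close> by \<open>ln z \<le> z - 1\<close>, and at least
  \<open>gibbs * ln v\<close> since \<open>gibbs \<le> 1\<close>. The bound is uniform in
  temperature and position, which makes the energy error integrable.\<close>

lemma abs_entropy_le: "\<bar>entropy s x\<bar> \<le> (\<Sum>a\<in>A. \<bar>ln (v a)\<bar> + v a)"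
proof -
  have ln_gibbs: "ln (v a / gibbs s x a) = ln (partition_sum s x) + (norm (x - a))\<^sup>2 / s" if "a \<in> A" for a
  proof -
    have "v a / gibbs s x a = partition_sum s x * exp ((norm (x - a))\<^sup>2 / s)"
      using weight_pos[OF that] partition_sum_pos[of s x]
      by (simp add: gibbs_def exp_minus field_simps)
    then show ?thesis using partition_sum_pos[of s x] by (simp add: ln_mult)
  qed
  have "(\<Sum>a\<in>A. gibbs s x a * ln (v a / gibbs s x a)) =
      (\<Sum>a\<in>A. gibbs s x a * ln (partition_sum s x)) + (\<Sum>a\<in>A. gibbs s x a * (norm (x - a))\<^sup>2 / s)"
    by (simp add: ln_gibbs distrib_left sum.distrib)
  also have "\<dots> = - entropy s x"
    by (simp add: entropy_def sum_distrib_right[symmetric] sum_gibbs sum_divide_distrib)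
  finally have "\<bar>entropy s x\<bar> = \<bar>\<Sum>a\<in>A. gibbs s x a * ln (v a / gibbs s x a)\<bar>" by simp
  also have "\<dots> \<le> (\<Sum>a\<in>A. \<bar>ln (v a)\<bar> + v a)"
  proof (rule order_trans[OF sum_abs], rule sum_mono)
    fix a assume a: "a \<in> A"
    have p: "0 < gibbs s x a" "gibbs s x a \<le> 1" and w: "0 < v a"
      using a gibbs_pos gibbs_le_1 weight_pos by auto
    have "gibbs s x a * ln (v a / gibbs s x a) \<le> gibbs s x a * (v a / gibbs s x a)"
      using p w ln_le_minus_one[of "v a / gibbs s x a"] by (intro mult_left_mono) auto
    then have up: "gibbs s x a * ln (v a / gibbs s x a) \<le> v a" using p by simp
    have "ln (v a) \<le> ln (v a / gibbs s x a)"
      using p w by (simp add: ln_div)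
    then have "gibbs s x a * ln (v a) \<le> gibbs s x a * ln (v a / gibbs s x a)"
      using p by (intro mult_left_mono) auto
    moreover have "gibbs s x a * \<bar>ln (v a)\<bar> \<le> 1 * \<bar>ln (v a)\<bar>"
      using p by (intro mult_right_mono) auto
    moreover have "gibbs s x a * (- ln (v a)) \<le> gibbs s x a * \<bar>ln (v a)\<bar>"
      using p by (intro mult_left_mono) auto
    ultimately show "\<bar>gibbs s x a * ln (v a / gibbs s x a)\<bar> \<le> \<bar>ln (v a)\<bar> + v a"
      using up w by (auto simp: abs_le_iff)
  qed
  finally show ?thesis .
qed

text \<open>A soft minimum of the squared distances to the points, which tends to the squared
  distance to \<open>A\<close> as \<open>s\<close> falls to 0.\<close>

definition soft_sqdist :: "real \<Rightarrow> 'a \<Rightarrow> real" where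
  "soft_sqdist s x = - s * ln (partition_sum s x)"

text \<open>Chain rule: the spatial gradient of \<open>soft_sqdist\<close> is twice the offset from
  the barycenter, its temperature derivative is \<open>entropy\<close>, and the temperature
  satisfies \<open>s' = - s\<close>.\<close>

lemma soft_sqdist_along_curve:
  fixes Y :: "real \<Rightarrow> 'a"
  assumes Y: "(Y has_vector_derivative Y') (at \<tau>)" and \<kappa>: "0 < \<kappa>"
  defines "s \<equiv> \<lambda>t. \<kappa> * exp (- t)"
  shows "((\<lambda>t. soft_sqdist (s t) (Y t)) has_real_derivative
      2 * ((Y \<tau> - barycenter (s \<tau>) (Y \<tau>)) \<bullet> Y') - s \<tau> * entropy (s \<tau>) (Y \<tau>)) (at \<tau>)"
proof -
  have s_pos: "0 < s t" for t using \<kappa> by (simp add: s_def)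
  have ds: "(s has_real_derivative - s \<tau>) (at \<tau>)"
    unfolding s_def by (auto intro!: derivative_eq_intros)
  define c where "c a t = (norm (Y t - a))\<^sup>2" for a t
  have dc: "(c a has_real_derivative 2 * ((Y \<tau> - a) \<bullet> Y')) (at \<tau>)" for a
  proof -
    have "((\<lambda>t. Y t - a) has_vector_derivative Y') (at \<tau>)"
      using has_vector_derivative_diff[OF Y has_vector_derivative_const] by simp
    from bounded_bilinear.has_vector_derivative[OF bounded_bilinear_inner this this]
    show ?thesis
      by (simp add: c_def[abs_def] power2_norm_eq_inner has_real_derivative_iff_has_vector_derivative inner_commute)
  qed
  \<comment> \<open>Quotient rule for \<open>- c / s\<close>, where \<open>s' = - s\<close> merges
    both terms over the single denominator \<open>s\<close>.\<close>
  define D where "D a = - (2 * ((Y \<tau> - a) \<bullet> Y') + c a \<tau>) / s \<tau>" for a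
  have dq: "((\<lambda>t. - (c a t / s t)) has_real_derivative D a) (at \<tau>)" for a
    using s_pos[of \<tau>] unfolding D_def
    by (auto intro!: derivative_eq_intros dc ds simp: field_simps power2_eq_square)
  have "((\<lambda>t. partition_sum (s t) (Y t)) has_real_derivative
      (\<Sum>a\<in>A. v a * (exp (- (c a \<tau> / s \<tau>)) * D a))) (at \<tau>)"
    unfolding partition_sum_def c_def[symmetric]
    by (intro DERIV_sum DERIV_cmult DERIV_fun_exp dq)
  from DERIV_chain2[OF DERIV_ln_divide[OF partition_sum_pos] this]
  have "((\<lambda>t. ln (partition_sum (s t) (Y t))) has_real_derivative
      1 / partition_sum (s \<tau>) (Y \<tau>) * (\<Sum>a\<in>A. v a * (exp (- (c a \<tau> / s \<tau>)) * D a))) (at \<tau>)" .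
  also have "1 / partition_sum (s \<tau>) (Y \<tau>) * (\<Sum>a\<in>A. v a * (exp (- (c a \<tau> / s \<tau>)) * D a)) =
      (\<Sum>a\<in>A. gibbs (s \<tau>) (Y \<tau>) a * D a)"
    unfolding sum_distrib_left by (intro sum.cong refl) (simp add: gibbs_def c_def)
  finally have dln: "((\<lambda>t. ln (partition_sum (s t) (Y t))) has_real_derivative
      (\<Sum>a\<in>A. gibbs (s \<tau>) (Y \<tau>) a * D a)) (at \<tau>)" .
  have "(\<Sum>a\<in>A. gibbs (s \<tau>) (Y \<tau>) a * D a) =
      - (2 * (\<Sum>a\<in>A. gibbs (s \<tau>) (Y \<tau>) a * ((Y \<tau> - a) \<bullet> Y')) +
        (\<Sum>a\<in>A. gibbs (s \<tau>) (Y \<tau>) a * c a \<tau>)) / s \<tau>"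
    by (simp add: D_def sum_distrib_left sum_divide_distrib[symmetric] sum.distrib[symmetric]
        sum_negf[symmetric] algebra_simps flip: sum_divide_distrib)
  also have "\<dots> = - (2 * ((Y \<tau> - barycenter (s \<tau>) (Y \<tau>)) \<bullet> Y')) / s \<tau>
      + entropy (s \<tau>) (Y \<tau>) + ln (partition_sum (s \<tau>) (Y \<tau>))"
    unfolding barycenter_offset by (simp add: entropy_def c_def add_divide_distrib diff_divide_distrib)
  finally have eq: "(\<Sum>a\<in>A. gibbs (s \<tau>) (Y \<tau>) a * D a) = \<dots>" .
  have "((\<lambda>t. - s t * ln (partition_sum (s t) (Y t))) has_real_derivative
      s \<tau> * ln (partition_sum (s \<tau>) (Y \<tau>)) - s \<tau> * (\<Sum>a\<in>A. gibbs (s \<tau>) (Y \<tau>) a * D a)) (at \<tau>)"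
    using DERIV_mult[OF DERIV_minus[OF ds] dln] by (simp add: mult.commute)
  moreover have "s \<tau> * ln (partition_sum (s \<tau>) (Y \<tau>)) - s \<tau> * (\<Sum>a\<in>A. gibbs (s \<tau>) (Y \<tau>) a * D a) =
      2 * ((Y \<tau> - barycenter (s \<tau>) (Y \<tau>)) \<bullet> Y') - s \<tau> * entropy (s \<tau>) (Y \<tau>)"
    unfolding eq using s_pos[of \<tau>] by (simp add: distrib_left right_diff_distrib)
  ultimately show ?thesis unfolding soft_sqdist_def by simp
qed

text \<open>The partition sum lies between its term at one point \<open>b\<close> and the total
  weight. The factor \<open>s\<close> cancels the \<open>1 / s\<close> in the logarithm of that
  term.\<close>

lemma soft_sqdist_bounded:
  assumes "0 \<le> R" "0 \<le> S"
  shows "\<exists>K. \<forall>s x. 0 < s \<longrightarrow> s \<le> S \<longrightarrow> norm x \<le> R \<longrightarrow> \<bar>soft_sqdist s x\<bar> \<le> K"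
proof -
  obtain b where b: "b \<in> A" using points_nonempty by blast
  define W where "W = (\<Sum>a\<in>A. v a)"
  have Wpos: "0 < W" unfolding W_def using finite_points points_nonempty weight_pos by (intro sum_pos) auto
  have "\<bar>soft_sqdist s x\<bar> \<le> S * (\<bar>ln W\<bar> + \<bar>ln (v b)\<bar>) + (R + norm b)\<^sup>2"
    if s: "0 < s" "s \<le> S" and x: "norm x \<le> R" for s x
  proof -
    have "partition_sum s x \<le> W"
      unfolding partition_sum_def W_def using weight_pos s
      by (intro sum_mono) (simp add: mult_left_le less_imp_le)
    then have up: "ln (partition_sum s x) \<le> ln W" using partition_sum_pos[of s x] Wpos by simp
    have "v b * exp (- ((norm (x - b))\<^sup>2 / s)) \<le> partition_sum s x"
      unfolding partition_sum_def using b finite_points weight_pos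
      by (intro member_le_sum) (auto simp: less_imp_le)
    then have "ln (v b * exp (- ((norm (x - b))\<^sup>2 / s))) \<le> ln (partition_sum s x)"
      using weight_pos[OF b] by (intro ln_mono) auto
    then have lo: "ln (v b) - (norm (x - b))\<^sup>2 / s \<le> ln (partition_sum s x)"
      using weight_pos[OF b] by (simp add: ln_mult)
    have "\<bar>ln (partition_sum s x)\<bar> \<le> (\<bar>ln W\<bar> + \<bar>ln (v b)\<bar>) + (norm (x - b))\<^sup>2 / s"
    proof -
      have "0 \<le> (norm (x - b))\<^sup>2 / s" using s by simp
      then show ?thesis using up lo by linarith
    qed
    then have "s * \<bar>ln (partition_sum s x)\<bar> \<le> s * ((\<bar>ln W\<bar> + \<bar>ln (v b)\<bar>) + (norm (x - b))\<^sup>2 / s)"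
      using s by (intro mult_left_mono) auto
    also have "\<dots> = s * (\<bar>ln W\<bar> + \<bar>ln (v b)\<bar>) + (norm (x - b))\<^sup>2"
      using s by (simp add: distrib_left)
    also have "\<dots> \<le> S * (\<bar>ln W\<bar> + \<bar>ln (v b)\<bar>) + (R + norm b)\<^sup>2"
      using s x norm_triangle_ineq4[of x b] by (intro add_mono mult_right_mono power_mono) auto
    finally show ?thesis using s by (simp add: soft_sqdist_def abs_mult)
  qed
  then show ?thesis by blast
qed

end

section \<open>The flow in logarithmic time\<close>

text \<open>Here \<open>\<kappa>\<close> stands for the initial temperature \<open>4 * T\<close>.
  The equation is posed at positive times because the original curve has only a one-sided derivative
  at \<open>T\<close>; the estimates start at time 1.\<close>

locale rescaled_flow =
  P1: weighted_points A1 v1 + P2: weighted_points A2 v2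
  for A1 :: "'a::euclidean_space set" and v1 and A2 :: "'a set" and v2 +
  fixes l \<kappa> :: real and Y :: "real \<Rightarrow> 'a"
  assumes scale_pos: "0 < \<kappa>"
    and flow: "\<And>\<tau>. 0 < \<tau> \<Longrightarrow> (Y has_vector_derivative
      - (1 / 2) *\<^sub>R (Y \<tau> - (l *\<^sub>R P1.barycenter (\<kappa> * exp (- \<tau>)) (Y \<tau>)
        + (1 - l) *\<^sub>R P2.barycenter (\<kappa> * exp (- \<tau>)) (Y \<tau>)))) (at \<tau>)"
begin

definition temp :: "real \<Rightarrow> real" where
  "temp \<tau> = \<kappa> * exp (- \<tau>)"

definition target :: "real \<Rightarrow> 'a" where
  "target \<tau> = l *\<^sub>R P1.barycenter (temp \<tau>) (Y \<tau>) + (1 - l) *\<^sub>R P2.barycenter (temp \<tau>) (Y \<tau>)"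

definition velocity :: "real \<Rightarrow> 'a" where
  "velocity \<tau> = - (1 / 2) *\<^sub>R (Y \<tau> - target \<tau>)"

lemma has_velocity: "0 < \<tau> \<Longrightarrow> (Y has_vector_derivative velocity \<tau>) (at \<tau>)"
  using flow by (simp add: velocity_def target_def temp_def)

lemma continuous_on_Y: "continuous_on {1..} Y"
  by (intro continuous_at_imp_continuous_on ballI has_vector_derivative_continuous[OF has_velocity]) simp

lemma temp_pos: "0 < temp \<tau>"
  using scale_pos by (simp add: temp_def)

lemma temp_tendsto_0: "filterlim temp (at_right 0) at_top"
proof -
  have "(temp \<longlongrightarrow> 0) at_top"
    unfolding temp_def
    by (intro tendsto_mult_right_zero filterlim_compose[OF exp_at_bot] filterlim_uminus_at_bot_at_top)
  then show ?thesis
    using temp_pos by (simp add: filterlim_at less_imp_neq[symmetric])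
qed

lemma target_bounded: "\<exists>B>0. \<forall>\<tau>. norm (target \<tau>) \<le> B"
proof -
  have "norm (target \<tau>) \<le> \<bar>l\<bar> * (\<Sum>a\<in>A1. norm a) + \<bar>1 - l\<bar> * (\<Sum>a\<in>A2. norm a)" for \<tau>
    unfolding target_def
    by (rule order_trans[OF norm_triangle_ineq], unfold norm_scaleR)
      (intro add_mono mult_left_mono P1.norm_barycenter_le P2.norm_barycenter_le abs_ge_zero)
  then have "norm (target \<tau>) \<le> max 1 (\<bar>l\<bar> * (\<Sum>a\<in>A1. norm a) + \<bar>1 - l\<bar> * (\<Sum>a\<in>A2. norm a))" for \<tau>
    by (simp add: le_max_iff_disj)
  then show ?thesis by (intro exI[of _ "max 1 _"]) auto
qed

lemma Y_bounded: "\<exists>R>0. \<forall>\<tau>\<ge>1. norm (Y \<tau>) \<le> R"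
proof -
  obtain B where B: "B > 0" "\<And>\<tau>. norm (target \<tau>) \<le> B" using target_bounded by blast
  have "norm (Y \<tau>) \<le> norm (Y 1) + B" if "\<tau> \<ge> 1" for \<tau>
  proof (cases "\<tau> = 1")
    case False
    \<comment> \<open>Integrating factor: the derivative of \<open>\<phi>\<close> involves only the
      bounded \<open>target\<close>.\<close>
    define \<phi> where "\<phi> t = exp (t / 2) *\<^sub>R Y t" for t
    have "norm (\<phi> \<tau> - \<phi> 1) \<le> B * exp (\<tau> / 2) - B * exp (1 / 2)"
    proof (rule differentiable_bound_general)
      show "continuous_on {1..\<tau>} \<phi>"
        unfolding \<phi>_def by (intro continuous_intros continuous_on_subset[OF continuous_on_Y]) auto
      show "continuous_on {1..\<tau>} (\<lambda>t. B * exp (t / 2))" by (intro continuous_intros) auto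
      fix t :: real assume t: "1 < t" "t < \<tau>"
      have "((\<lambda>t. exp (t / 2)) has_real_derivative exp (t / 2) / 2) (at t)"
        by (auto intro!: derivative_eq_intros)
      from has_vector_derivative_scaleR[OF this has_velocity[of t]] t
      show "(\<phi> has_vector_derivative (exp (t / 2) / 2) *\<^sub>R target t) (at t)"
        by (simp add: \<phi>_def[abs_def] velocity_def algebra_simps)
      have "((\<lambda>t. B * exp (t / 2)) has_real_derivative B * (exp (t / 2) / 2)) (at t)"
        by (auto intro!: derivative_eq_intros)
      then show "((\<lambda>t. B * exp (t / 2)) has_vector_derivative B * (exp (t / 2) / 2)) (at t)"
        by (simp add: has_real_derivative_iff_has_vector_derivative)
      show "norm ((exp (t / 2) / 2) *\<^sub>R target t) \<le> B * (exp (t / 2) / 2)"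
        using B(2)[of t] by (simp add: mult.commute)
    qed (use False that in auto)
    then have "norm (\<phi> \<tau>) \<le> norm (\<phi> 1) + B * exp (\<tau> / 2) - B * exp (1 / 2)"
      using norm_triangle_ineq2[of "\<phi> \<tau>" "\<phi> 1"] by linarith
    also have "\<dots> \<le> exp (1 / 2) * norm (Y 1) + B * exp (\<tau> / 2)"
      using B(1) by (simp add: \<phi>_def)
    also have "\<dots> \<le> exp (\<tau> / 2) * norm (Y 1) + B * exp (\<tau> / 2)"
      using that by (intro add_right_mono mult_right_mono) auto
    also have "\<dots> = exp (\<tau> / 2) * (norm (Y 1) + B)" by (simp add: algebra_simps)
    finally show ?thesis by (simp add: \<phi>_def)
  qed (use B in simp)
  then show ?thesis using B(1) by (intro exI[of _ "norm (Y 1) + B"]) (auto intro: add_nonneg_pos)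
qed

lemma velocity_bounded: "\<exists>M>0. \<forall>\<tau>\<ge>1. norm (velocity \<tau>) \<le> M"
proof -
  obtain B where B: "B > 0" "\<And>\<tau>. norm (target \<tau>) \<le> B" using target_bounded by blast
  obtain R where R: "R > 0" "\<And>\<tau>. \<tau> \<ge> 1 \<Longrightarrow> norm (Y \<tau>) \<le> R" using Y_bounded by blast
  have "norm (velocity \<tau>) \<le> R + B" if "\<tau> \<ge> 1" for \<tau>
  proof -
    have "norm (velocity \<tau>) \<le> norm (Y \<tau> - target \<tau>)" by (simp add: velocity_def)
    also have "\<dots> \<le> R + B" using norm_triangle_ineq4[of "Y \<tau>" "target \<tau>"] R(2)[OF that] B(2)[of \<tau>] by linarith
    finally show ?thesis .
  qed
  then show ?thesis using R(1) B(1) by (intro exI[of _ "R + B"]) auto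
qed

text \<open>The decreasing temperature makes the energy grow at most at the integrable rate
  \<open>C * temp \<tau>\<close>; adding the integral of this rate makes it monotone.\<close>
lemma lyapunov_function:
  "\<exists>H H'. (\<forall>\<tau>\<ge>1. (H has_real_derivative H' \<tau>) (at \<tau>) \<and>
      H' \<tau> \<le> - 4 * (norm (velocity \<tau>))\<^sup>2) \<and> bdd_below (H ` {1..})"
proof -
  define e where "e \<tau> = l * P1.entropy (temp \<tau>) (Y \<tau>) + (1 - l) * P2.entropy (temp \<tau>) (Y \<tau>)" for \<tau>
  define C where "C = \<bar>l\<bar> * (\<Sum>a\<in>A1. \<bar>ln (v1 a)\<bar> + v1 a) + \<bar>1 - l\<bar> * (\<Sum>a\<in>A2. \<bar>ln (v2 a)\<bar> + v2 a)"
  have eC: "\<bar>e \<tau>\<bar> \<le> C" for \<tau>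
    unfolding e_def C_def
    by (rule order_trans[OF abs_triangle_ineq], unfold abs_mult)
      (intro add_mono mult_left_mono P1.abs_entropy_le P2.abs_entropy_le abs_ge_zero)
  define H where "H \<tau> = l * P1.soft_sqdist (temp \<tau>) (Y \<tau>) + (1 - l) * P2.soft_sqdist (temp \<tau>) (Y \<tau>)
    + C * temp \<tau>" for \<tau>
  define H' where "H' \<tau> = - 4 * (norm (velocity \<tau>))\<^sup>2 - temp \<tau> * (C + e \<tau>)" for \<tau>
  have "(H has_real_derivative H' \<tau>) (at \<tau>)" if "1 \<le> \<tau>" for \<tau>
  proof -
    have Y: "(Y has_vector_derivative velocity \<tau>) (at \<tau>)" using that by (intro has_velocity) simp
    have "(temp has_real_derivative - temp \<tau>) (at \<tau>)"
      unfolding temp_def by (auto intro!: derivative_eq_intros)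
    note DERIV_cmult[OF this, of C]
    from DERIV_add[OF DERIV_add[OF
          DERIV_cmult[OF P1.soft_sqdist_along_curve[OF Y scale_pos, folded temp_def], of l]
          DERIV_cmult[OF P2.soft_sqdist_along_curve[OF Y scale_pos, folded temp_def], of "1 - l"]] this]
    have "(H has_real_derivative
        l * (2 * ((Y \<tau> - P1.barycenter (temp \<tau>) (Y \<tau>)) \<bullet> velocity \<tau>) - temp \<tau> * P1.entropy (temp \<tau>) (Y \<tau>))
        + (1 - l) * (2 * ((Y \<tau> - P2.barycenter (temp \<tau>) (Y \<tau>)) \<bullet> velocity \<tau>)
          - temp \<tau> * P2.entropy (temp \<tau>) (Y \<tau>))
        + C * - temp \<tau>) (at \<tau>)"
      unfolding H_def .
    also have "l * (2 * ((Y \<tau> - P1.barycenter (temp \<tau>) (Y \<tau>)) \<bullet> velocity \<tau>) - temp \<tau> * P1.entropy (temp \<tau>) (Y \<tau>))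
        + (1 - l) * (2 * ((Y \<tau> - P2.barycenter (temp \<tau>) (Y \<tau>)) \<bullet> velocity \<tau>)
          - temp \<tau> * P2.entropy (temp \<tau>) (Y \<tau>))
        + C * - temp \<tau> = 2 * ((Y \<tau> - target \<tau>) \<bullet> velocity \<tau>) - temp \<tau> * (C + e \<tau>)"
      by (simp add: e_def target_def inner_diff_left inner_add_left algebra_simps)
    \<comment> \<open>This identity turns the drift term into \<open>- 4\<close> times the squared
      speed.\<close>
    also have "Y \<tau> - target \<tau> = - 2 *\<^sub>R velocity \<tau>" by (simp add: velocity_def)
    finally show ?thesis by (simp add: H'_def power2_norm_eq_inner)
  qed
  moreover have "H' \<tau> \<le> - 4 * (norm (velocity \<tau>))\<^sup>2" for \<tau>
  proof -
    have "0 \<le> C + e \<tau>" using eC[of \<tau>] by linarith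
    then have "0 \<le> temp \<tau> * (C + e \<tau>)" using temp_pos[of \<tau>] by simp
    then show ?thesis by (simp add: H'_def)
  qed
  moreover have "bdd_below (H ` {1..})"
  proof -
    obtain R where R: "R > 0" "\<And>\<tau>. \<tau> \<ge> 1 \<Longrightarrow> norm (Y \<tau>) \<le> R" using Y_bounded by blast
    obtain K1 where K1: "\<And>s x. 0 < s \<Longrightarrow> s \<le> \<kappa> \<Longrightarrow> norm x \<le> R \<Longrightarrow> \<bar>P1.soft_sqdist s x\<bar> \<le> K1"
      using P1.soft_sqdist_bounded[of R \<kappa>] R(1) scale_pos by auto
    obtain K2 where K2: "\<And>s x. 0 < s \<Longrightarrow> s \<le> \<kappa> \<Longrightarrow> norm x \<le> R \<Longrightarrow> \<bar>P2.soft_sqdist s x\<bar> \<le> K2"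
      using P2.soft_sqdist_bounded[of R \<kappa>] R(1) scale_pos by auto
    \<comment> \<open>Two-sided bounds on the soft distances are used because \<open>1 - l\<close>
      may be negative.\<close>
    have "- (\<bar>l\<bar> * K1 + \<bar>1 - l\<bar> * K2) \<le> H \<tau>" if "\<tau> \<ge> 1" for \<tau>
    proof -
      have s: "0 < temp \<tau>" "temp \<tau> \<le> \<kappa>"
        using temp_pos that scale_pos by (auto simp: temp_def mult_left_le)
      have "\<bar>l * P1.soft_sqdist (temp \<tau>) (Y \<tau>)\<bar> \<le> \<bar>l\<bar> * K1"
        unfolding abs_mult using s R(2)[OF that] by (intro mult_left_mono K1) auto
      moreover have "\<bar>(1 - l) * P2.soft_sqdist (temp \<tau>) (Y \<tau>)\<bar> \<le> \<bar>1 - l\<bar> * K2"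
        unfolding abs_mult using s R(2)[OF that] by (intro mult_left_mono K2) auto
      moreover have "0 \<le> C * temp \<tau>" using s eC[of \<tau>] by (intro mult_nonneg_nonneg) auto
      ultimately show ?thesis unfolding H_def by linarith
    qed
    then show ?thesis by (intro bdd_belowI2) simp
  qed
  ultimately show ?thesis by blast
qed

text \<open>After a late passage near \<open>y\<close> the curve stays near \<open>y\<close> for a fixed time, during which the
  energy hardly decreases, so that the speed must be small at some instant.\<close>
lemma slow_passage:
  assumes y: "y \<in> omega_limit Y" and "0 < \<epsilon>" "0 < r"
  obtains \<tau> where "\<tau>0 \<le> \<tau>" "dist (Y \<tau>) y < r" "norm (velocity \<tau>) < \<epsilon>"
proof -
  obtain M where M: "M > 0" "\<And>\<tau>. \<tau> \<ge> 1 \<Longrightarrow> norm (velocity \<tau>) \<le> M" using velocity_bounded by blast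
  obtain H H' where
      HH': "\<forall>\<tau>\<ge>1. (H has_real_derivative H' \<tau>) (at \<tau>) \<and> H' \<tau> \<le> - 4 * (norm (velocity \<tau>))\<^sup>2"
    and bdd: "bdd_below (H ` {1..})" using lyapunov_function by blast
  have H: "(H has_real_derivative H' \<tau>) (at \<tau>)"
    and H': "H' \<tau> \<le> - 4 * (norm (velocity \<tau>))\<^sup>2" if "1 \<le> \<tau>" for \<tau>
    using HH' that by auto
  have contH: "continuous_on {a..b} H" if "1 \<le> a" for a b
    using that H by (intro DERIV_continuous_on[of _ H H']) (auto intro: has_field_derivative_at_within)
  have decr: "H b \<le> H a" if "1 \<le> a" "a \<le> b" for a b
  proof (rule DERIV_nonpos_imp_nonincreasing[OF that(2)])
    fix x assume "a \<le> x" "x \<le> b"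
    moreover have "- 4 * (norm (velocity x))\<^sup>2 \<le> 0" by simp
    ultimately show "\<exists>d. DERIV H x :> d \<and> d \<le> 0"
      using H[of x] H'[of x] that by (meson order_trans)
  qed
  \<comment> \<open>At speed at most \<open>M\<close> the curve moves by at most
    \<open>r / 2\<close> in time \<open>h\<close>; the other half of the radius is spent on the
    starting point.\<close>
  define h where "h = r / (2 * M)"
  have h: "h > 0" using M \<open>0 < r\<close> by (simp add: h_def)
  \<comment> \<open>From \<open>\<tau>1\<close> on, the monotone energy is so close to its infimum
    that any interval of length \<open>h\<close> loses less than
    \<open>4 * \<epsilon>\<^sup>2 * h\<close>.\<close>
  obtain \<tau>1 where \<tau>1: "1 \<le> \<tau>1" "H \<tau>1 < (INF \<tau>\<in>{1..}. H \<tau>) + 4 * \<epsilon>\<^sup>2 * h"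
    using cINF_less_iff[OF _ bdd, of "(INF \<tau>\<in>{1..}. H \<tau>) + 4 * \<epsilon>\<^sup>2 * h"] h \<open>0 < \<epsilon>\<close> by auto
  obtain \<sigma> where \<sigma>: "filterlim \<sigma> at_top sequentially" "(\<lambda>n. Y (\<sigma> n)) \<longlonglongrightarrow> y"
    using y by (auto simp: omega_limit_def)
  have "\<forall>\<^sub>F n in sequentially. max \<tau>0 \<tau>1 \<le> \<sigma> n"
    using \<sigma>(1) unfolding filterlim_at_top by blast
  moreover have "\<forall>\<^sub>F n in sequentially. dist (Y (\<sigma> n)) y < r / 2"
    using tendstoD[OF \<sigma>(2), of "r / 2"] \<open>0 < r\<close> by simp
  ultimately have "\<forall>\<^sub>F n in sequentially. max \<tau>0 \<tau>1 \<le> \<sigma> n \<and> dist (Y (\<sigma> n)) y < r / 2"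
    by (rule eventually_conj)
  then obtain a where a: "\<tau>0 \<le> a" "\<tau>1 \<le> a" "dist (Y a) y < r / 2"
    by (auto dest: eventually_happens)
  have a1: "1 \<le> a" using a \<tau>1 by simp
  have "a < a + h" using h by simp
  \<comment> \<open>The mean value theorem picks an instant of average dissipation, below
    \<open>4 * \<epsilon>\<^sup>2\<close>, and therefore of speed below
    \<open>\<epsilon>\<close>.\<close>
  then obtain \<tau> where \<tau>: "a < \<tau>" "\<tau> < a + h" and eq: "H (a + h) - H a = h * H' \<tau>"
    using MVT2[of a "a + h" H H'] H a1 by force
  have "H a < (INF \<tau>\<in>{1..}. H \<tau>) + 4 * \<epsilon>\<^sup>2 * h" using decr[of \<tau>1 a] a \<tau>1 by simp
  also have "(INF \<tau>\<in>{1..}. H \<tau>) \<le> H (a + h)" using a1 h by (intro cINF_lower bdd) auto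
  finally have "- 4 * \<epsilon>\<^sup>2 * h < h * H' \<tau>" using eq by simp
  also have "\<dots> \<le> h * (- 4 * (norm (velocity \<tau>))\<^sup>2)"
    using h H'[of \<tau>] \<tau> a1 by (intro mult_left_mono) auto
  finally have "h * (norm (velocity \<tau>))\<^sup>2 < h * \<epsilon>\<^sup>2" by simp
  then have "(norm (velocity \<tau>))\<^sup>2 < \<epsilon>\<^sup>2" using h by simp
  then have small: "norm (velocity \<tau>) < \<epsilon>" using \<open>0 < \<epsilon>\<close> by (simp add: power_less_imp_less_base)
  have "norm (Y \<tau> - Y a) \<le> M * \<tau> - M * a"
  proof (rule differentiable_bound_general[OF \<tau>(1)])
    show "continuous_on {a..\<tau>} Y" using a1 by (intro continuous_on_subset[OF continuous_on_Y]) auto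
    show "continuous_on {a..\<tau>} (\<lambda>t. M * t)" by (intro continuous_intros)
    fix t assume t: "a < t" "t < \<tau>"
    show "(Y has_vector_derivative velocity t) (at t)" using a1 t by (intro has_velocity) auto
    show "((\<lambda>t. M * t) has_vector_derivative M) (at t)"
      by (auto intro!: derivative_eq_intros simp flip: has_real_derivative_iff_has_vector_derivative)
    show "norm (velocity t) \<le> M" using a1 t by (intro M) auto
  qed
  also have "\<dots> = M * (\<tau> - a)" by (simp add: algebra_simps)
  also have "\<dots> \<le> M * h" using \<tau> M by (intro mult_left_mono) auto
  also have "\<dots> = r / 2" using M by (simp add: h_def)
  finally have "dist (Y \<tau>) y < r"
    using a(3) dist_triangle[of "Y \<tau>" y "Y a"] by (simp add: dist_norm)
  then show thesis using small a(1) \<tau>(1) by (intro that[of \<tau>]) auto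
qed

text \<open>At a late slow passage near \<open>y\<close> the curve almost equals its target, and the
  target is close to the compact set \<open>K\<close> of combinations of the two hulls. Hence
  \<open>y\<close> lies in the closure of \<open>K\<close>, that is, in \<open>K\<close>.\<close>

lemma omega_limit_balanced:
  assumes y: "y \<in> omega_limit Y"
  shows "\<exists>p\<in>convex hull (nearest A1 y). \<exists>q\<in>convex hull (nearest A2 y). y = l *\<^sub>R p + (1 - l) *\<^sub>R q"
proof -
  define K where "K = (\<lambda>(p, q). l *\<^sub>R p + (1 - l) *\<^sub>R q) `
    ((convex hull (nearest A1 y)) \<times> (convex hull (nearest A2 y)))"
  have "finite (nearest A1 y)" "finite (nearest A2 y)"
    using P1.finite_points P2.finite_points by (auto simp: nearest_def)
  then have "compact K"
    unfolding K_def case_prod_beta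
    by (intro compact_continuous_image compact_Times finite_imp_compact_convex_hull continuous_intros)
  then have "closed K" by (rule compact_imp_closed)
  have "\<exists>z\<in>K. dist z y < e" if e: "0 < e" for e
  proof -
    \<comment> \<open>The shares of the error: one for the distance to \<open>y\<close>, two for
      twice the velocity, and the moduli of the coefficients for the two barycenters.\<close>
    define \<epsilon> where "\<epsilon> = e / (3 + \<bar>l\<bar> + \<bar>1 - l\<bar>)"
    have den: "0 < 3 + \<bar>l\<bar> + \<bar>1 - l\<bar>" by linarith
    have \<epsilon>: "0 < \<epsilon>" using e den by (simp add: \<epsilon>_def)
    \<comment> \<open>The filter of late times at which the curve is near \<open>y\<close>. An
      eventual property along it holds once \<open>\<tau>\<close> is late and
      \<open>Y \<tau>\<close> is near \<open>y\<close>, as \<open>slow_passage\<close>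
      ensures.\<close>
    define F where "F = inf at_top (filtercomap Y (nhds y))"
    have Y: "(Y \<longlongrightarrow> y) F" unfolding F_def
      by (rule filterlim_mono[OF filterlim_filtercomap order_refl inf_le2])
    have temp: "filterlim temp (at_right 0) F" unfolding F_def
      by (rule filterlim_mono[OF temp_tendsto_0 order_refl inf_le1])
    have "\<forall>\<^sub>F \<tau> in F. (\<exists>p\<in>convex hull (nearest A1 y). norm (P1.barycenter (temp \<tau>) (Y \<tau>) - p) < \<epsilon>) \<and>
        (\<exists>q\<in>convex hull (nearest A2 y). norm (P2.barycenter (temp \<tau>) (Y \<tau>) - q) < \<epsilon>) \<and> dist (Y \<tau>) y < \<epsilon>"
      using P1.eventually_barycenter_near_hull[OF Y temp \<epsilon>]
        P2.eventually_barycenter_near_hull[OF Y temp \<epsilon>] tendstoD[OF Y \<epsilon>]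
      by (intro eventually_conj)
    then obtain Q R where Q: "\<forall>\<^sub>F \<tau> in at_top. Q \<tau>" and R: "\<forall>\<^sub>F \<tau> in filtercomap Y (nhds y). R \<tau>"
      and QR: "\<And>\<tau>. Q \<tau> \<Longrightarrow> R \<tau> \<Longrightarrow>
        (\<exists>p\<in>convex hull (nearest A1 y). norm (P1.barycenter (temp \<tau>) (Y \<tau>) - p) < \<epsilon>) \<and>
        (\<exists>q\<in>convex hull (nearest A2 y). norm (P2.barycenter (temp \<tau>) (Y \<tau>) - q) < \<epsilon>) \<and> dist (Y \<tau>) y < \<epsilon>"
      unfolding F_def eventually_inf by blast
    obtain \<tau>0 where \<tau>0: "\<And>\<tau>. \<tau>0 \<le> \<tau> \<Longrightarrow> Q \<tau>" using Q by (auto simp: eventually_at_top_linorder)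
    obtain r where r: "0 < r" "\<And>\<tau>. dist (Y \<tau>) y < r \<Longrightarrow> R \<tau>"
      using R by (auto simp: eventually_filtercomap eventually_nhds_metric)
    obtain \<tau> where \<tau>: "\<tau>0 \<le> \<tau>" "dist (Y \<tau>) y < r" "norm (velocity \<tau>) < \<epsilon>"
      using slow_passage[OF y \<epsilon> r(1)] by blast
    obtain p q where p: "p \<in> convex hull (nearest A1 y)" "norm (P1.barycenter (temp \<tau>) (Y \<tau>) - p) < \<epsilon>"
      and q: "q \<in> convex hull (nearest A2 y)" "norm (P2.barycenter (temp \<tau>) (Y \<tau>) - q) < \<epsilon>"
      and near: "dist (Y \<tau>) y < \<epsilon>"
      using QR[of \<tau>] \<tau>0 r(2) \<tau> by blast
    let ?z = "l *\<^sub>R p + (1 - l) *\<^sub>R q"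
    have "y - ?z = (y - Y \<tau>) + (- 2) *\<^sub>R velocity \<tau> +
        l *\<^sub>R (P1.barycenter (temp \<tau>) (Y \<tau>) - p) + (1 - l) *\<^sub>R (P2.barycenter (temp \<tau>) (Y \<tau>) - q)"
      by (simp add: velocity_def target_def algebra_simps)
    also have "norm \<dots> \<le> norm (y - Y \<tau>) + 2 * norm (velocity \<tau>) +
        \<bar>l\<bar> * norm (P1.barycenter (temp \<tau>) (Y \<tau>) - p) + \<bar>1 - l\<bar> * norm (P2.barycenter (temp \<tau>) (Y \<tau>) - q)"
      by (rule norm_triangle_le add_mono order_refl | simp)+
    also have "\<dots> < \<epsilon> + 2 * \<epsilon> + \<bar>l\<bar> * \<epsilon> + \<bar>1 - l\<bar> * \<epsilon>"
      using near \<tau>(3) p(2) q(2) by (intro add_less_le_mono mult_left_mono add_strict_mono)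
        (auto simp: dist_norm norm_minus_commute)
    also have "\<dots> = \<epsilon> * (3 + \<bar>l\<bar> + \<bar>1 - l\<bar>)" by (simp add: algebra_simps)
    also have "\<dots> = e" using den by (simp add: \<epsilon>_def)
    finally have "dist ?z y < e" by (simp add: dist_norm norm_minus_commute)
    moreover have "?z \<in> K" using p q by (auto simp: K_def)
    ultimately show ?thesis by blast
  qed
  then have "y \<in> closure K" by (simp add: closure_approachable)
  then have "y \<in> K" using closure_closed[OF \<open>closed K\<close>] by simp
  then show ?thesis by (auto simp: K_def)
qed

end

section \<open>Heat flows of Dirac mixtures\<close>

text \<open>The points in the definition of a mixture may repeat, so it is rewritten over its
  support with the mass of each atom as weight. The complement of the support is null, so
  \<open>f\<close> agrees almost everywhere with a finite sum of indicators.\<close>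

lemma finite_dirac_mixture_imp:
  fixes \<mu> :: "'a::euclidean_space measure"
  assumes "finite_dirac_mixture \<mu>"
  defines "A \<equiv> measure_support \<mu>" and "v \<equiv> \<lambda>a. measure \<mu> {a}"
  shows "weighted_points A v"
    and "\<And>f :: 'a \<Rightarrow> real. f \<in> borel_measurable borel \<Longrightarrow> (\<integral>y. f y \<partial>\<mu>) = (\<Sum>a\<in>A. v a * f a)"
proof -
  obtain n :: nat and w a where n: "1 \<le> n" and w: "\<And>k. k \<in> {1..n} \<Longrightarrow> 0 < w k"
    and em: "\<And>B. B \<in> sets borel \<Longrightarrow>
      emeasure \<mu> B = (\<Sum>k=1..n. ennreal (w k) * emeasure (return borel (a k)) B)"
    and sets: "sets \<mu> = sets borel"
    using assms(1) unfolding finite_dirac_mixture_def by blast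
  have A: "A = a ` {1..n}" unfolding A_def by (rule measure_support_dirac_mixture[OF w em])
  have em': "emeasure \<mu> B = (\<Sum>k=1..n. ennreal (w k) * indicator B (a k))" if "B \<in> sets borel" for B
    using that by (simp add: em)
  have fin: "emeasure \<mu> B < \<infinity>" if "B \<in> sets borel" for B
    unfolding em'[OF that] by (auto simp: less_top[symmetric] indicator_def)
  have finA: "finite A" by (simp add: A)
  show "weighted_points A v"
  proof
    show "finite A" by fact
    show "A \<noteq> {}" using n by (simp add: A)
    fix x assume "x \<in> A"
    then have "emeasure \<mu> {x} \<noteq> 0"
      by (subst em') (use w in \<open>force simp: A ennreal_eq_0_iff not_le indicator_def\<close>)+
    then show "0 < v x"
      using fin[of "{x}"] by (simp add: v_def measure_def enn2real_positive_iff zero_less_iff_neq_zero)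
  qed
  have "closed A" using finA by (rule finite_imp_closed)
  then have Aset: "A \<in> sets borel" "- A \<in> sets borel" by auto
  have "emeasure \<mu> (- A) = 0"
    by (subst em'[OF Aset(2)]) (auto simp: A)
  then have "- A \<in> null_sets \<mu>" using Aset sets by (auto intro: null_setsI)
  then have AE: "AE y in \<mu>. y \<in> A" by (rule AE_I') auto
  fix f :: "'a \<Rightarrow> real" assume f: "f \<in> borel_measurable borel"
  have eq: "f y = (\<Sum>a\<in>A. f a * indicator {a} y)" if "y \<in> A" for y
    using finA that by (simp add: indicator_def of_bool_def sum.delta if_distrib cong: if_cong)
  have Ms: "{a} \<in> sets \<mu>" for a using sets by simp
  have "(\<integral>y. f y \<partial>\<mu>) = (\<integral>y. (\<Sum>a\<in>A. f a * indicator {a} y) \<partial>\<mu>)"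
    using f Ms AE eq
    by (intro integral_cong_AE) (auto simp: measurable_cong_sets[OF sets refl] elim!: eventually_mono)
  also have "\<dots> = (\<Sum>a\<in>A. f a * v a)"
    using Ms fin by (subst Bochner_Integration.integral_sum) (auto simp: v_def)
  finally show "(\<integral>y. f y \<partial>\<mu>) = (\<Sum>a\<in>A. v a * f a)" by (simp add: mult.commute)
qed

lemma heat_flow_mixture:
  fixes \<mu> :: "'a::euclidean_space measure"
  assumes "finite_dirac_mixture \<mu>"
  shows "heat_flow \<mu> x t = (4 * pi * t) powr (- (real DIM('a) / 2)) *
    weighted_points.partition_sum (measure_support \<mu>) (\<lambda>a. measure \<mu> {a}) (4 * t) x"
proof -
  interpret weighted_points "measure_support \<mu>" "\<lambda>a. measure \<mu> {a}"
    by (rule finite_dirac_mixture_imp(1)[OF assms])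
  have "heat_flow \<mu> x t = (\<Sum>a\<in>measure_support \<mu>. measure \<mu> {a} * heat_kernel t (x - a))"
    unfolding heat_flow_def heat_kernel_def
    by (rule finite_dirac_mixture_imp(2)[OF assms]) measurable
  then show ?thesis
    by (simp add: partition_sum_def heat_kernel_def sum_distrib_left ac_simps)
qed

lemma GDERIV_combination:
  assumes "GDERIV f x :> D" "GDERIV g x :> E"
  shows "GDERIV (\<lambda>x. k * (c + f x) + l * (c + g x)) x :> k *\<^sub>R D + l *\<^sub>R E"
  using assms unfolding gderiv_def
  by (auto intro!: derivative_eq_intros simp: fun_eq_iff inner_add_right)

text \<open>The Gaussian prefactor is constant in \<open>x\<close> and drops out, and the
  coefficients sum to 1, so the two offsets combine into one.\<close>

lemma grad_heat_potential:
  fixes \<mu>1 \<mu>2 :: "'a::euclidean_space measure"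
  assumes \<mu>: "finite_dirac_mixture \<mu>1" "finite_dirac_mixture \<mu>2" and t: "0 < t"
  shows "grad (\<lambda>x. heat_potential l \<mu>1 \<mu>2 x t) x = - (1 / (2 * t)) *\<^sub>R (x -
    (l *\<^sub>R weighted_points.barycenter (measure_support \<mu>1) (\<lambda>a. measure \<mu>1 {a}) (4 * t) x +
    (1 - l) *\<^sub>R weighted_points.barycenter (measure_support \<mu>2) (\<lambda>a. measure \<mu>2 {a}) (4 * t) x))"
proof -
  interpret P1: weighted_points "measure_support \<mu>1" "\<lambda>a. measure \<mu>1 {a}"
    by (rule finite_dirac_mixture_imp(1)[OF \<mu>(1)])
  interpret P2: weighted_points "measure_support \<mu>2" "\<lambda>a. measure \<mu>2 {a}"
    by (rule finite_dirac_mixture_imp(1)[OF \<mu>(2)])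
  define c where "c = ln ((4 * pi * t) powr (- (real DIM('a) / 2)))"
  have "(\<lambda>x. heat_potential l \<mu>1 \<mu>2 x t) = (\<lambda>x. l * (c + ln (P1.partition_sum (4 * t) x)) +
      (1 - l) * (c + ln (P2.partition_sum (4 * t) x)))"
    using t P1.partition_sum_pos P2.partition_sum_pos
    by (simp add: heat_potential_def heat_flow_mixture \<mu> ln_mult c_def less_imp_neq[symmetric])
  moreover have "GDERIV \<dots> x :>
      l *\<^sub>R (- (2 / (4 * t)) *\<^sub>R (x - P1.barycenter (4 * t) x)) +
      (1 - l) *\<^sub>R (- (2 / (4 * t)) *\<^sub>R (x - P2.barycenter (4 * t) x))"
    by (rule GDERIV_combination P1.GDERIV_ln_partition_sum P2.GDERIV_ln_partition_sum)+
  ultimately have "grad (\<lambda>x. heat_potential l \<mu>1 \<mu>2 x t) x =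
      l *\<^sub>R (- (2 / (4 * t)) *\<^sub>R (x - P1.barycenter (4 * t) x)) +
      (1 - l) *\<^sub>R (- (2 / (4 * t)) *\<^sub>R (x - P2.barycenter (4 * t) x))"
    by (simp only: grad_eqI)
  also have "\<dots> = - (1 / (2 * t)) *\<^sub>R (l *\<^sub>R (x - P1.barycenter (4 * t) x)
      + (1 - l) *\<^sub>R (x - P2.barycenter (4 * t) x))"
    by (simp add: scaleR_add_right mult.commute)
  also have "l *\<^sub>R (x - P1.barycenter (4 * t) x) + (1 - l) *\<^sub>R (x - P2.barycenter (4 * t) x) =
      x - (l *\<^sub>R P1.barycenter (4 * t) x + (1 - l) *\<^sub>R P2.barycenter (4 * t) x)"
    by (simp add: algebra_simps)
  finally show ?thesis .
qed

section \<open>Passage to logarithmic time, criticality of the limit points, and return to the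
  original time\<close>

theorem theorem3p18:
  fixes l T :: real
    and u1 u2 :: "'a::euclidean_space measure"
    and A1 A2 :: "'a set"
    and xT :: 'a
    and X Y :: "real \<Rightarrow> 'a"
  assumes "0 \<le> l" and "0 < T"
    and "finite_dirac_mixture u1" and "finite_dirac_mixture u2"
    and "A1 = measure_support u1" and "A2 = measure_support u2"
    and "\<forall>t\<in>{0<..T}.
           (X has_vector_derivative - grad (\<lambda>x. heat_potential l u1 u2 x t) (X t))
             (at t within {0<..T})"
    and "X T = xT"
    and "\<forall>\<tau>\<ge>0. Y \<tau> = X (T * exp (- \<tau>))"
    and "l \<le> 1 \<longrightarrow>
           omega_limit Y \<inter>
             (clarke_crit (geom_potential l A1 A2) - local_minimizers (geom_potential l A1 A2)) = {}"
    and "1 < l \<longrightarrow>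
           omega_limit Y \<inter>
             (outer_crit l A1 A2 - local_minimizers (geom_potential l A1 A2)) = {}"
  shows "\<exists>x\<in>local_minimizers (geom_potential l A1 A2).
           (Y \<longlongrightarrow> x) at_top \<and> (X \<longlongrightarrow> x) (at_right 0)"
proof -
  note u = assms(3,4) and T = \<open>0 < T\<close>
  note A = assms(5,6)
  define v1 where "v1 a = measure u1 {a}" for a
  define v2 where "v2 a = measure u2 {a}" for a
  interpret P1: weighted_points A1 v1
    using finite_dirac_mixture_imp(1)[OF u(1)] by (simp add: A v1_def[abs_def])
  interpret P2: weighted_points A2 v2
    using finite_dirac_mixture_imp(1)[OF u(2)] by (simp add: A v2_def[abs_def])
  define b where "b s x = l *\<^sub>R P1.barycenter s x + (1 - l) *\<^sub>R P2.barycenter s x" for s x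
  have grad: "grad (\<lambda>x. heat_potential l u1 u2 x t) x = - (1 / (2 * t)) *\<^sub>R (x - b (4 * t) x)"
    if "0 < t" for t x
    using grad_heat_potential[OF u that] by (simp add: A v1_def[abs_def] v2_def[abs_def] b_def)
  interpret rescaled_flow A1 v1 A2 v2 l "4 * T" Y
  proof
    show "0 < 4 * T" using T by simp
    fix \<tau> :: real assume \<tau>: "0 < \<tau>"
    define t where "t = T * exp (- \<tau>)"
    have t: "0 < t" "t < T" using T \<tau> by (auto simp: t_def)
    have "(X has_vector_derivative (1 / (2 * t)) *\<^sub>R (X t - b (4 * t) (X t))) (at t within {0<..T})"
      using assms(7)[rule_format, of t] t grad[OF t(1), of "X t"] by simp
    \<comment> \<open>For \<open>\<tau> > 0\<close> the time \<open>t\<close> is interior, so the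
      derivative within the half-open interval is a full one.\<close>
    then have "(X has_vector_derivative (1 / (2 * t)) *\<^sub>R (X t - b (4 * t) (X t))) (at t within {0<..<T})"
      by (rule has_vector_derivative_within_subset) auto
    then have dX: "(X has_vector_derivative (1 / (2 * t)) *\<^sub>R (X t - b (4 * t) (X t))) (at t)"
      using t by (simp add: at_within_open[of t "{0<..<T}"])
    have "((\<lambda>\<tau>. T * exp (- \<tau>)) has_vector_derivative - t) (at \<tau>)"
      unfolding t_def
      by (auto intro!: derivative_eq_intros simp flip: has_real_derivative_iff_has_vector_derivative)
    from vector_diff_chain_at[OF this dX[unfolded t_def]]
    have "((\<lambda>\<tau>. X (T * exp (- \<tau>))) has_vector_derivative
        (- t) *\<^sub>R (1 / (2 * t)) *\<^sub>R (X t - b (4 * t) (X t))) (at \<tau>)"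
      by (simp add: o_def t_def)
    \<comment> \<open>The factor \<open>- t\<close> of the time change cancels the singular
      \<open>1 / t\<close> of the gradient.\<close>
    moreover have "(- t) *\<^sub>R (1 / (2 * t)) *\<^sub>R (X t - b (4 * t) (X t)) = - (1 / 2) *\<^sub>R (Y \<tau> - b (4 * t) (Y \<tau>))"
      using t \<tau> assms(9) by (simp add: t_def)
    ultimately have "((\<lambda>\<tau>. X (T * exp (- \<tau>))) has_vector_derivative
        - (1 / 2) *\<^sub>R (Y \<tau> - b (4 * t) (Y \<tau>))) (at \<tau>)" by simp
    then have "(Y has_vector_derivative - (1 / 2) *\<^sub>R (Y \<tau> - b (4 * t) (Y \<tau>))) (at \<tau>)"
      by (rule has_vector_derivative_transform_within_open[of _ _ _ "{0<..}"]) (use \<tau> assms(9) in auto)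
    then show "(Y has_vector_derivative - (1 / 2) *\<^sub>R (Y \<tau> -
        (l *\<^sub>R P1.barycenter (4 * T * exp (- \<tau>)) (Y \<tau>) +
        (1 - l) *\<^sub>R P2.barycenter (4 * T * exp (- \<tau>)) (Y \<tau>)))) (at \<tau>)"
      by (simp add: b_def t_def mult.assoc)
  qed
  have min: "y \<in> local_minimizers (geom_potential l A1 A2)" if y: "y \<in> omega_limit Y" for y
  proof -
    obtain p q where pq: "p \<in> convex hull (nearest A1 y)" "q \<in> convex hull (nearest A2 y)"
      and y_eq: "y = l *\<^sub>R p + (1 - l) *\<^sub>R q"
      using omega_limit_balanced[OF y] by blast
    show ?thesis
    proof (cases "l \<le> 1")
      case True
      have "2 *\<^sub>R (y - (l *\<^sub>R p + (1 - l) *\<^sub>R q)) \<in> clarke_subdiff (geom_potential l A1 A2) y"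
        using P1.finite_points P1.points_nonempty P2.finite_points P2.points_nonempty assms(1) True pq
        by (rule clarke_subdiff_geom_potential)
      then have "y \<in> clarke_crit (geom_potential l A1 A2)"
        by (simp add: clarke_crit_def flip: y_eq)
      then show ?thesis using assms(10) True y by blast
    next
      case False
      \<comment> \<open>Subgradients of the two squared distances are chosen separately, as the
        Minkowski sum permits; the balance of \<open>y\<close> makes their combination
        vanish.\<close>
      have "l *\<^sub>R (2 *\<^sub>R (y - p)) + (1 - l) *\<^sub>R (2 *\<^sub>R (y - q)) \<in> outer_clarke_subdiff l A1 A2 y"
        unfolding outer_clarke_subdiff_def
        using clarke_subdiff_infdist_sq[OF P1.finite_points P1.points_nonempty pq(1)]
          clarke_subdiff_infdist_sq[OF P2.finite_points P2.points_nonempty pq(2)] by blast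
      also have "l *\<^sub>R (2 *\<^sub>R (y - p)) + (1 - l) *\<^sub>R (2 *\<^sub>R (y - q)) =
          2 *\<^sub>R (y - (l *\<^sub>R p + (1 - l) *\<^sub>R q))" by (simp add: algebra_simps)
      finally have "y \<in> outer_crit l A1 A2"
        by (simp add: outer_crit_def flip: y_eq)
      then show ?thesis using assms(11) False y by force
    qed
  qed
  have "finite (omega_limit Y)"
    using finite_local_minimizers_geom_potential[OF P1.finite_points P1.points_nonempty
        P2.finite_points P2.points_nonempty] min by (meson finite_subset subsetI)
  moreover have "bounded (Y ` {1..})"
    using Y_bounded by (auto simp: bounded_iff)
  ultimately obtain x where x: "x \<in> omega_limit Y" "(Y \<longlongrightarrow> x) at_top"
    using convergent_if_finite_omega_limit[of Y 1] continuous_on_Y by blast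
  \<comment> \<open>\<open>ln T - ln t\<close> is the inverse of the time change and tends to
    infinity as \<open>t\<close> falls to 0.\<close>
  have "filterlim (\<lambda>t. ln T - ln t) at_top (at_right 0)"
    using filterlim_tendsto_add_at_top[OF tendsto_const[of "ln T"], of "\<lambda>t. - ln t" "at_right 0"] ln_at_0
    by (simp add: filterlim_uminus_at_top)
  then have "((\<lambda>t. Y (ln T - ln t)) \<longlongrightarrow> x) (at_right 0)"
    by (rule filterlim_compose[OF x(2)])
  moreover have "\<forall>\<^sub>F t in at_right 0. Y (ln T - ln t) = X t"
    unfolding eventually_at_right_field
  proof (intro exI[of _ T] conjI allI impI T)
    fix t assume t: "0 < t" "t < T"
    then have "0 \<le> ln T - ln t" by simp
    then have "Y (ln T - ln t) = X (T * exp (- (ln T - ln t)))" using assms(9) by blast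
    also have "T * exp (- (ln T - ln t)) = t" using t T by (simp add: exp_diff)
    finally show "Y (ln T - ln t) = X t" .
  qed
  ultimately have "(X \<longlongrightarrow> x) (at_right 0)" by (rule Lim_transform_eventually)
  then show ?thesis using x min by blast
qed

end
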